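(* Let $(\varphi,\psi)\in\mathfrak t^0_3\times\mathfrak t^0_{3,2}$ be a pair of Lie elements with $c_{B(0)}(\psi)=c_{AB(0)}(\psi)=0$ which satisfies the mixed pentagon equation in $\mathfrak t^0_{4,2}$: $$\psi(t^{12},t^{23}_++t^{24}_+,t^{23}_-+t^{24}_-)+\psi(t^{13}+t^{23}_++t^{23}_-,t^{34}_+,t^{34}_-)$$ $$=\varphi(t^{23}_+,t^{34}_+)+\psi(t^{12}+t^{13}+t^{23}_++t^{23}_-,t^{24}_++t^{34}_+,t^{24}_-+t^{34}_-)+\psi(t^{12},t^{23}_+,t^{23}_-).$$ Then $\psi$ satisfies the octagon equation in $\mathfrak t^0_{3,2}$: $$\psi(A,B(0),B(1))-\psi(A,B(1),B(0))+\psi(C,B(1),B(0))-\psi(C,B(0),B(1))=0,$$ where $C$ is defined by $A+B(0)+B(1)+C=0$.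
   Context: Let $\mathbf k$ be a field of characteristic $0$. For $n\geqslant2$, $\mathfrak t_{n,2}$ is the completed (with respect to the grading where generators have degree 1) $\mathbf k$-Lie algebra with generators $t^{1i}$ ($2\leqslant i\leqslant n$) and $t(a)^{ij}$ ($i\ne j$, $2\leqslant i,j\leqslant n$, $a\in\mathbf Z/2\mathbf Z$) and relations, for all $a,b\in\mathbf Z/2\mathbf Z$ and all distinct $i,j,k,l\in\{2,\dots,n\}$: $t(a)^{ij}=t(-a)^{ji}$; $[t(a)^{ij},t(a+b)^{ik}+t(b)^{jk}]=0$; $[t^{1i}+t^{1j}+\sum_c t(c)^{ij},t(a)^{ij}]=0$; $[t^{1i},t^{1j}+\sum_c t(c)^{ij}]=0$; $[t^{1i},t(a)^{jk}]=0$; $[t(a)^{ij},t(b)^{kl}]=0$ (sums over $c\in\mathbf Z/2\mathbf Z$). Write $t^{ij}_+=t(0)^{ij}$, $t^{ij}_-=t(1)^{ij}$. $\mathfrak t^0_{n,2}\subset\mathfrak t_{n,2}$ is the (completed) Lie subalgebra generated by all these generators except $t^{1n}$. $\mathfrak t^0_{3,2}$ is the completed free Lie algebra on $A:=t^{12}$, $B(0):=t^{23}_+$, $B(1):=t^{23}_-$. $\mathfrak t^0_3$ is the completed free Lie algebra over $\mathbf k$ on two generators $A,B$. For $\varphi\in\mathfrak t^0_3$, $\varphi(X,Y)$ is the image of $\varphi$ under $A\mapsto X,B\mapsto Y$; for $\psi\in\mathfrak t^0_{3,2}$, $\psi(X,Y_0,Y_1)$ is the image of $\psi$ under $A\mapsto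 X$, $B(0)\mapsto Y_0$, $B(1)\mapsto Y_1$. $c_W(\psi)$ is the coefficient of the noncommutative monomial $W$ in $\psi$, viewed in $\mathbf k\langle\langle A,B(0),B(1)\rangle\rangle$. *)

theory Defs
  imports "HOL-Library.Z2"
begin

section \<open>Noncommutative formal power series\<close>

typedef ('x, 'k) ncps = "UNIV :: ('x list \<Rightarrow> 'k) set"
  morphisms coeff Abs_ncps ..

setup_lifting type_definition_ncps

lemma ncps_eq_iff: "f = g \<longleftrightarrow> (\<forall>w. coeff f w = coeff g w)"
  by (metis coeff_inject ext)

instantiation ncps :: (type, ring_1) ring_1
begin

lift_definition zero_ncps :: "('a, 'b) ncps" is "\<lambda>_. 0" .
lift_definition one_ncps :: "('a, 'b) ncps" is "\<lambda>w. if w = [] then 1 else 0" .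
lift_definition plus_ncps :: "('a, 'b) ncps \<Rightarrow> ('a, 'b) ncps \<Rightarrow> ('a, 'b) ncps"
  is "\<lambda>f g w. f w + g w" .
lift_definition uminus_ncps :: "('a, 'b) ncps \<Rightarrow> ('a, 'b) ncps" is "\<lambda>f w. - f w" .
lift_definition minus_ncps :: "('a, 'b) ncps \<Rightarrow> ('a, 'b) ncps \<Rightarrow> ('a, 'b) ncps"
  is "\<lambda>f g w. f w - g w" .
lift_definition times_ncps :: "('a, 'b) ncps \<Rightarrow> ('a, 'b) ncps \<Rightarrow> ('a, 'b) ncps"
  is "\<lambda>f g w. \<Sum>i\<le>length w. f (take i w) * g (drop i w)" .

instance
proof
  fix a b c :: "('a, 'b) ncps"
  show "a * b * c = a * (b * c)"
  proof (transfer, rule ext)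
    fix f g h :: "'a list \<Rightarrow> 'b" and w :: "'a list"
    let ?n = "length w"
    let ?F = "\<lambda>i j. f (take i w) * g (drop i (take j w)) * h (drop j w)"
    have "(\<Sum>j\<le>?n. (\<Sum>i\<le>length (take j w). f (take i (take j w)) * g (drop i (take j w))) * h (drop j w))
        = (\<Sum>j\<le>?n. \<Sum>i\<le>j. ?F i j)"
      by (intro sum.cong refl) (auto simp: sum_distrib_right min_def intro!: sum.cong)
    also have "\<dots> = (\<Sum>j\<le>?n. \<Sum>i\<le>?n. if i \<le> j then ?F i j else 0)"
      by (intro sum.cong refl sum.mono_neutral_cong_left) auto
    also have "\<dots> = (\<Sum>i\<le>?n. \<Sum>j\<le>?n. if i \<le> j then ?F i j else 0)"
      by (rule sum.swap)
    also have "\<dots> = (\<Sum>i\<le>?n. \<Sum>j\<in>{i..?n}. ?F i j)"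
      by (intro sum.cong refl sum.mono_neutral_cong_right) auto
    also have "\<dots> = (\<Sum>i\<le>?n. f (take i w) *
         (\<Sum>j\<le>length (drop i w). g (take j (drop i w)) * h (drop j (drop i w))))"
    proof (intro sum.cong refl)
      fix i assume "i \<in> {..?n}"
      then have *: "{i..?n} = (\<lambda>j. j + i) ` {..?n - i}"
        by (auto simp: image_iff) (metis atMost_iff diff_le_mono le_add_diff_inverse2)
      have "(\<Sum>j\<in>{i..?n}. ?F i j) = (\<Sum>j\<le>?n - i. ?F i (j + i))"
        unfolding * by (subst sum.reindex) (auto simp: inj_on_def)
      also have "\<dots> = (\<Sum>j\<le>?n - i. f (take i w) * (g (take j (drop i w)) * h (drop j (drop i w))))"
        by (intro sum.cong refl) (simp add: drop_take mult.assoc)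
      finally show "(\<Sum>j\<in>{i..?n}. ?F i j) = f (take i w) *
         (\<Sum>j\<le>length (drop i w). g (take j (drop i w)) * h (drop j (drop i w)))"
        by (simp add: sum_distrib_left)
    qed
    finally show "(\<Sum>j\<le>?n. (\<Sum>i\<le>length (take j w). f (take i (take j w)) * g (drop i (take j w))) * h (drop j w))
      = (\<Sum>i\<le>?n. f (take i w) *
         (\<Sum>j\<le>length (drop i w). g (take j (drop i w)) * h (drop j (drop i w))))" .
  qed
  show "1 * a = a"
  proof (transfer, rule ext)
    fix f :: "'a list \<Rightarrow> 'b" and w :: "'a list"
    have "(\<Sum>i\<le>length w. (if take i w = [] then 1 else 0) * f (drop i w))
        = (\<Sum>i\<le>length w. if i = 0 then f w else 0)"
      by (intro sum.cong refl) auto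
    then show "(\<Sum>i\<le>length w. (if take i w = [] then 1 else 0) * f (drop i w)) = f w"
      by simp
  qed
  show "a * 1 = a"
  proof (transfer, rule ext)
    fix f :: "'a list \<Rightarrow> 'b" and w :: "'a list"
    have "(\<Sum>i\<le>length w. f (take i w) * (if drop i w = [] then 1 else 0))
        = (\<Sum>i\<le>length w. if i = length w then f w else 0)"
      by (intro sum.cong refl) auto
    then show "(\<Sum>i\<le>length w. f (take i w) * (if drop i w = [] then 1 else 0)) = f w"
      by simp
  qed
  show "(0::('a, 'b) ncps) \<noteq> 1"
    by transfer (auto dest: fun_cong[where x = "[]"])
qed (transfer; simp add: fun_eq_iff algebra_simps sum.distrib)+

end

lift_definition scale :: "'k::ring_1 \<Rightarrow> ('x, 'k) ncps \<Rightarrow> ('x, 'k) ncps"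
  is "\<lambda>c f w. c * f w" .

lift_definition var :: "'x \<Rightarrow> ('x, 'k::ring_1) ncps"
  is "\<lambda>x w. if w = [x] then 1 else 0" .

lift_definition hom_part :: "nat \<Rightarrow> ('x, 'k::ring_1) ncps \<Rightarrow> ('x, 'k) ncps"
  is "\<lambda>d f w. if length w = d then f w else 0" .

definition bracket :: "('x, 'k::ring_1) ncps \<Rightarrow> ('x, 'k) ncps \<Rightarrow> ('x, 'k) ncps"
  where "bracket f g = f * g - g * f"

text \<open>The image of \<open>f\<close> under the continuous algebra homomorphism given by \<open>x \<mapsto> \<sigma> x\<close>, for a finite
  alphabet and series \<open>\<sigma> x\<close> without constant term. Then the image of a word \<open>w\<close> has no terms of
  degree below \<open>length w\<close>, so the words longer than \<open>v\<close> do not contribute to the coefficient of \<open>v\<close>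
  and may be left out of the sum, which makes it finite.\<close>

definition subst :: "('x::finite \<Rightarrow> ('y, 'k) ncps) \<Rightarrow> ('x, 'k::ring_1) ncps \<Rightarrow> ('y, 'k) ncps"
  where "subst \<sigma> f =
    Abs_ncps (\<lambda>v. \<Sum>w | length w \<le> length v. coeff f w * coeff (prod_list (map \<sigma> w)) v)"


section \<open>Completed free Lie algebras\<close>

text \<open>The free Lie algebra on \<open>X\<close>, realised as the Lie subalgebra of the free associative algebra
  generated by \<open>X\<close>.\<close>

inductive_set lie_poly :: "'x set \<Rightarrow> ('x, 'k::field) ncps set" for X where
  var: "x \<in> X \<Longrightarrow> var x \<in> lie_poly X"
| zero: "0 \<in> lie_poly X"
| add: "f \<in> lie_poly X \<Longrightarrow> g \<in> lie_poly X \<Longrightarrow> f + g \<in> lie_poly X"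
| scale: "f \<in> lie_poly X \<Longrightarrow> scale c f \<in> lie_poly X"
| bracket: "f \<in> lie_poly X \<Longrightarrow> g \<in> lie_poly X \<Longrightarrow> bracket f g \<in> lie_poly X"

text \<open>The closure of a graded subspace with respect to the degree filtration, i.e. the product of its
  homogeneous components.\<close>

definition completion :: "('x, 'k::field) ncps set \<Rightarrow> ('x, 'k) ncps set"
  where "completion V = {f. \<forall>d. hom_part d f \<in> V}"

definition free_lie :: "'x set \<Rightarrow> ('x, 'k::field) ncps set"
  where "free_lie X = completion (lie_poly X)"

inductive_set lie_ideal :: "('x, 'k::field) ncps set \<Rightarrow> ('x, 'k) ncps set \<Rightarrow> ('x, 'k) ncps set"
  for L R where
  rel: "r \<in> R \<Longrightarrow> r \<in> lie_ideal L R"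
| zero: "0 \<in> lie_ideal L R"
| add: "f \<in> lie_ideal L R \<Longrightarrow> g \<in> lie_ideal L R \<Longrightarrow> f + g \<in> lie_ideal L R"
| scale: "f \<in> lie_ideal L R \<Longrightarrow> scale c f \<in> lie_ideal L R"
| bracket: "f \<in> L \<Longrightarrow> g \<in> lie_ideal L R \<Longrightarrow> bracket f g \<in> lie_ideal L R"


section \<open>The Lie algebras $\mathfrak t_{n,2}$ and $\mathfrak t^0_{n,2}$\<close>

instance bit :: finite
proof
  have "(UNIV :: bit set) = {0, 1}"
    using bit.exhaust by auto
  then show "finite (UNIV :: bit set)"
    by (metis finite.emptyI finite_insert)
qed

text \<open>\<open>T1 i\<close> stands for $t^{1i}$ and \<open>T a i j\<close> for $t(a)^{ij}$; the type \<^typ>\<open>bit\<close> is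
  $\mathbf Z/2\mathbf Z$.\<close>

datatype gen = T1 nat | T bit nat nat

definition gens :: "nat \<Rightarrow> gen set"
  where "gens n = T1 ` {2..n} \<union> {T a i j | a i j. i \<in> {2..n} \<and> j \<in> {2..n} \<and> i \<noteq> j}"

abbreviation t1 :: "nat \<Rightarrow> (gen, 'k::field) ncps"
  where "t1 i \<equiv> var (T1 i)"

abbreviation ta :: "bit \<Rightarrow> nat \<Rightarrow> nat \<Rightarrow> (gen, 'k::field) ncps"
  where "ta a i j \<equiv> var (T a i j)"

abbreviation tp :: "nat \<Rightarrow> nat \<Rightarrow> (gen, 'k::field) ncps"
  where "tp i j \<equiv> ta 0 i j"

abbreviation tm :: "nat \<Rightarrow> nat \<Rightarrow> (gen, 'k::field) ncps"
  where "tm i j \<equiv> ta 1 i j"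

inductive_set rels :: "nat \<Rightarrow> (gen, 'k::field) ncps set" for n where
  sym: "{i, j} \<subseteq> {2..n} \<Longrightarrow> distinct [i, j] \<Longrightarrow>
    ta a i j - ta (- a) j i \<in> rels n"
| infinitesimal: "{i, j, k} \<subseteq> {2..n} \<Longrightarrow> distinct [i, j, k] \<Longrightarrow>
    bracket (ta a i j) (ta (a + b) i k + ta b j k) \<in> rels n"
| central: "{i, j} \<subseteq> {2..n} \<Longrightarrow> distinct [i, j] \<Longrightarrow>
    bracket (t1 i + t1 j + (\<Sum>c\<in>UNIV. ta c i j)) (ta a i j) \<in> rels n"
| mixed: "{i, j} \<subseteq> {2..n} \<Longrightarrow> distinct [i, j] \<Longrightarrow>
    bracket (t1 i) (t1 j + (\<Sum>c\<in>UNIV. ta c i j)) \<in> rels n"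
| comm1: "{i, j, k} \<subseteq> {2..n} \<Longrightarrow> distinct [i, j, k] \<Longrightarrow>
    bracket (t1 i) (ta a j k) \<in> rels n"
| comm: "{i, j, k, l} \<subseteq> {2..n} \<Longrightarrow> distinct [i, j, k, l] \<Longrightarrow>
    bracket (ta a i j) (ta b k l) \<in> rels n"

text \<open>The relations are homogeneous, so $\mathfrak t_{n,2}$ is the quotient of the completed free Lie
  algebra by the completion of the ideal they generate. Its elements are cosets.\<close>

definition t_ideal :: "nat \<Rightarrow> (gen, 'k::field) ncps set"
  where "t_ideal n = completion (lie_ideal (lie_poly (gens n)) (rels n))"

definition t_class :: "nat \<Rightarrow> (gen, 'k::field) ncps \<Rightarrow> (gen, 'k) ncps set"
  where "t_class n f = {g. g - f \<in> t_ideal n}"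

definition t_alg :: "nat \<Rightarrow> (gen, 'k::field) ncps set set"
  where "t_alg n = t_class n ` free_lie (gens n)"

definition t0_alg :: "nat \<Rightarrow> (gen, 'k::field) ncps set set"
  where "t0_alg n = t_class n ` free_lie (gens n - {T1 n})"


section \<open>Substitution\<close>

datatype ab = LA | LB

instance ab :: finite
proof
  have "(UNIV :: ab set) = {LA, LB}"
    using ab.exhaust by auto
  then show "finite (UNIV :: ab set)"
    by (metis finite.emptyI finite_insert)
qed

datatype ab3 = A | B bit

instance ab3 :: finite
proof
  have "(UNIV :: ab3 set) = insert A (range B)"
    by (metis UNIV_eq_I ab3.exhaust insertCI rangeI)
  moreover have "finite (insert A (range B))"
    by simp
  ultimately show "finite (UNIV :: ab3 set)"
    by metis
qed

definition subst2 :: "(ab, 'k) ncps \<Rightarrow> ('y, 'k::field) ncps \<Rightarrow> ('y, 'k) ncps \<Rightarrow> ('y, 'k) ncps"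
  where "subst2 \<phi> X Y = subst (case_ab X Y) \<phi>"

definition subst3 ::
  "(ab3, 'k) ncps \<Rightarrow> ('y, 'k::field) ncps \<Rightarrow> ('y, 'k) ncps \<Rightarrow> ('y, 'k) ncps \<Rightarrow> ('y, 'k) ncps"
  where "subst3 \<psi> X Y0 Y1 = subst (case_ab3 X (case_bit Y0 Y1)) \<psi>"


section \<open>Substitution preserves Lie series\<close>

lemma coeff_add [simp]: "coeff (f + g) w = coeff f w + coeff g w"
  by transfer simp

lemma coeff_diff [simp]: "coeff (f - g) w = coeff f w - coeff g w"
  by transfer simp

lemma coeff_zero [simp]: "coeff 0 w = 0"
  by transfer simp

lemma coeff_one: "coeff 1 w = (if w = [] then 1 else 0)"
  by transfer simp

lemma coeff_mult: "coeff (f * g) w = (\<Sum>i\<le>length w. coeff f (take i w) * coeff g (drop i w))"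
  by transfer simp

lemma coeff_scale [simp]: "coeff (scale c f) w = c * coeff f w"
  by transfer simp

lemma coeff_var: "coeff (var x) w = (if w = [x] then 1 else 0)"
  by transfer simp

lemma coeff_hom_part: "coeff (hom_part d f) w = (if length w = d then coeff f w else 0)"
  by transfer simp

lemma coeff_subst:
  "coeff (subst \<sigma> f) v = (\<Sum>w | length w \<le> length v. coeff f w * coeff (prod_list (map \<sigma> w)) v)"
  by (simp add: subst_def Abs_ncps_inverse)

lemma finite_lists_le: "finite {w :: 'x::finite list. length w \<le> n}"
  using finite_lists_length_le[of "UNIV :: 'x set" n] by simp

context
  fixes \<sigma> :: "'x::finite \<Rightarrow> ('y, 'k::field) ncps"
  assumes hom: "\<And>x. hom_part 1 (\<sigma> x) = \<sigma> x"
begin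

lemma coeff_sigma: "length v \<noteq> 1 \<Longrightarrow> coeff (\<sigma> x) v = 0"
  by (metis coeff_hom_part hom)

lemma coeff_word: "length v \<noteq> length w \<Longrightarrow> coeff (prod_list (map \<sigma> w)) v = 0"
proof (induction w arbitrary: v)
  case Nil
  then show ?case by (simp add: coeff_one)
next
  case (Cons x w)
  have "coeff (\<sigma> x) (take i v) * coeff (prod_list (map \<sigma> w)) (drop i v) = 0"
    if "i \<le> length v" for i
  proof (cases "i = 1")
    case True
    then have "length (drop i v) \<noteq> length w"
      using Cons.prems that by auto
    then show ?thesis
      using Cons.IH by simp
  next
    case False
    then show ?thesis
      using that by (simp add: coeff_sigma)
  qed
  then show ?case
    by (auto simp: coeff_mult intro!: sum.neutral)
qed

lemma coeff_subst_hom: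
  "coeff (subst \<sigma> f) v = (\<Sum>w | length w = length v. coeff f w * coeff (prod_list (map \<sigma> w)) v)"
  unfolding coeff_subst
  by (rule sum.mono_neutral_right) (auto simp: finite_lists_le coeff_word)

lemma coeff_prod_word:
  assumes "length u + length u' = length v"
  shows "coeff (prod_list (map \<sigma> (u @ u'))) v
    = coeff (prod_list (map \<sigma> u)) (take (length u) v) * coeff (prod_list (map \<sigma> u')) (drop (length u) v)"
proof -
  have "coeff (prod_list (map \<sigma> (u @ u'))) v
    = (\<Sum>i\<le>length v. if i = length u then coeff (prod_list (map \<sigma> u)) (take (length u) v)
        * coeff (prod_list (map \<sigma> u')) (drop (length u) v) else 0)"
    by (simp only: map_append prod_list.append coeff_mult)
      (rule sum.cong, auto simp: coeff_word)
  then show ?thesis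
    using assms by simp
qed

lemma subst_hom_part: "hom_part d (subst \<sigma> f) = subst \<sigma> (hom_part d f)"
  by (auto simp: ncps_eq_iff coeff_hom_part coeff_subst_hom intro!: sum.cong)

lemma subst_mult: "subst \<sigma> (f * g) = subst \<sigma> f * subst \<sigma> g"
  unfolding ncps_eq_iff
proof
  fix v :: "'y list"
  let ?n = "length v"
  let ?W = "\<lambda>w. coeff (prod_list (map \<sigma> w))"
  let ?L = "\<lambda>n. {w :: 'x list. length w = n}"
  have "coeff (subst \<sigma> (f * g)) v
      = (\<Sum>w\<in>?L ?n. \<Sum>i\<le>?n. coeff f (take i w) * coeff g (drop i w) * ?W w v)"
    by (auto simp: coeff_subst_hom coeff_mult sum_distrib_right intro!: sum.cong)
  also have "\<dots> = (\<Sum>i\<le>?n. \<Sum>w\<in>?L ?n. coeff f (take i w) * coeff g (drop i w) * ?W w v)"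
    by (rule sum.swap)
  also have "\<dots> = (\<Sum>i\<le>?n. coeff (subst \<sigma> f) (take i v) * coeff (subst \<sigma> g) (drop i v))"
  proof (rule sum.cong[OF refl])
    fix i assume i: "i \<in> {..?n}"
    have word: "?W w v = ?W (take i w) (take i v) * ?W (drop i w) (drop i v)" if "length w = ?n" for w
      using coeff_prod_word[of "take i w" "drop i w" v] i that by (simp only: append_take_drop_id) simp
    have "(\<Sum>w\<in>?L ?n. coeff f (take i w) * coeff g (drop i w) * ?W w v)
        = (\<Sum>(u, u')\<in>?L i \<times> ?L (?n - i). (coeff f u * ?W u (take i v)) * (coeff g u' * ?W u' (drop i v)))"
      by (rule sum.reindex_bij_witness[where i = "\<lambda>(u, u'). u @ u'" and j = "\<lambda>w. (take i w, drop i w)"])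
        (use i in \<open>auto simp: min_def word\<close>)
    then show "(\<Sum>w\<in>?L ?n. coeff f (take i w) * coeff g (drop i w) * ?W w v)
        = coeff (subst \<sigma> f) (take i v) * coeff (subst \<sigma> g) (drop i v)"
      using i by (simp add: coeff_subst_hom sum_product sum.cartesian_product min_def)
  qed
  finally show "coeff (subst \<sigma> (f * g)) v = coeff (subst \<sigma> f * subst \<sigma> g) v"
    by (simp add: coeff_mult)
qed

lemma subst_add: "subst \<sigma> (f + g) = subst \<sigma> f + subst \<sigma> g"
  by (simp add: ncps_eq_iff coeff_subst distrib_right sum.distrib)

lemma subst_diff: "subst \<sigma> (f - g) = subst \<sigma> f - subst \<sigma> g"
  by (simp add: ncps_eq_iff coeff_subst left_diff_distrib sum_subtractf)

lemma subst_scale: "subst \<sigma> (scale c f) = scale c (subst \<sigma> f)"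
  by (simp add: ncps_eq_iff coeff_subst sum_distrib_left mult.assoc)

lemma subst_var: "subst \<sigma> (var x) = \<sigma> x"
  unfolding ncps_eq_iff
proof
  fix v
  have "coeff (subst \<sigma> (var x)) v
      = (\<Sum>w | length w = length v. if w = [x] then coeff (\<sigma> x) v else 0)"
    unfolding coeff_subst_hom by (rule sum.cong) (auto simp: coeff_var)
  also have "\<dots> = coeff (\<sigma> x) v"
  proof -
    have "finite {w :: 'x list. length w = length v}"
      by (rule finite_subset[OF _ finite_lists_le[of "length v"]]) auto
    then show ?thesis
      by (auto simp: coeff_sigma)
  qed
  finally show "coeff (subst \<sigma> (var x)) v = coeff (\<sigma> x) v" .
qed

lemma subst_lie_poly:
  assumes "\<And>x. \<sigma> x \<in> lie_poly X" and "f \<in> lie_poly UNIV"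
  shows "subst \<sigma> f \<in> lie_poly X"
  using assms(2)
proof induction
  case zero
  have "subst \<sigma> 0 = 0"
    by (simp add: ncps_eq_iff coeff_subst)
  then show ?case
    by (simp add: lie_poly.zero)
next
  case (bracket f g)
  have "subst \<sigma> (bracket f g) = bracket (subst \<sigma> f) (subst \<sigma> g)"
    by (simp add: bracket_def subst_diff subst_mult)
  with bracket show ?case
    by (simp add: lie_poly.bracket)
qed (simp_all add: subst_var subst_add subst_scale assms(1) lie_poly.add lie_poly.scale)

lemma subst_free_lie:
  assumes "\<And>x. \<sigma> x \<in> lie_poly X" and "f \<in> free_lie UNIV"
  shows "subst \<sigma> f \<in> free_lie X"
  using assms by (auto simp: free_lie_def completion_def subst_hom_part intro: subst_lie_poly)

end

lemma hom_part_var: "hom_part 1 (var x) = var x"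
  by (auto simp: ncps_eq_iff coeff_hom_part coeff_var)

lemma hom_part_add: "hom_part d (f + g) = hom_part d f + hom_part d g"
  by (auto simp: ncps_eq_iff coeff_hom_part)

lemma free_lie_add: "f \<in> free_lie X \<Longrightarrow> g \<in> free_lie X \<Longrightarrow> f + g \<in> free_lie X"
  by (auto simp: free_lie_def completion_def hom_part_add intro: lie_poly.add)

lemma subst2_free_lie:
  assumes "\<phi> \<in> free_lie UNIV" "\<And>f. f \<in> {X, Y} \<Longrightarrow> f \<in> lie_poly S \<and> hom_part 1 f = f"
  shows "subst2 \<phi> X Y \<in> free_lie S"
  unfolding subst2_def by (rule subst_free_lie) (use assms in \<open>auto split: ab.split\<close>)

lemma subst3_free_lie:
  assumes "\<psi> \<in> free_lie UNIV" "\<And>f. f \<in> {X, Y0, Y1} \<Longrightarrow> f \<in> lie_poly S \<and> hom_part 1 f = f"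
  shows "subst3 \<psi> X Y0 Y1 \<in> free_lie S"
  unfolding subst3_def by (rule subst_free_lie) (use assms in \<open>auto split: ab3.split bit.split\<close>)

text \<open>Both sides of the mixed pentagon equation are elements of $\mathfrak t^0_{4,2}$; as this is a
  subalgebra of $\mathfrak t_{4,2}$, equality in it is equality of cosets modulo \<open>t_ideal 4\<close>.\<close>

lemma pentagon_sides_in_t0:
  assumes "\<phi> \<in> free_lie UNIV" and "\<psi> \<in> free_lie UNIV"
  shows "t_class 4
          (subst3 \<psi> (t1 2) (tp 2 3 + tp 2 4) (tm 2 3 + tm 2 4)
           + subst3 \<psi> (t1 3 + tp 2 3 + tm 2 3) (tp 3 4) (tm 3 4)) \<in> t0_alg 4" (is "?l \<in> _")
    and "t_class 4
          (subst2 \<phi> (tp 2 3) (tp 3 4)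
           + subst3 \<psi> (t1 2 + t1 3 + tp 2 3 + tm 2 3) (tp 2 4 + tp 3 4) (tm 2 4 + tm 3 4)
           + subst3 \<psi> (t1 2) (tp 2 3) (tm 2 3)) \<in> t0_alg 4" (is "?r \<in> _")
proof -
  have "t1 i \<in> lie_poly (gens 4 - {T1 4})" if "i \<in> {2, 3}" for i
    using that by (intro lie_poly.var) (auto simp: gens_def)
  moreover have "ta a i j \<in> lie_poly (gens 4 - {T1 4})" if "(i, j) \<in> {(2, 3), (2, 4), (3, 4)}" for a i j
    using that by (intro lie_poly.var) (auto simp: gens_def)
  ultimately have *: "subst3 \<psi> (t1 2) (tp 2 3 + tp 2 4) (tm 2 3 + tm 2 4) \<in> free_lie (gens 4 - {T1 4})"
    "subst3 \<psi> (t1 3 + tp 2 3 + tm 2 3) (tp 3 4) (tm 3 4) \<in> free_lie (gens 4 - {T1 4})"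
    "subst2 \<phi> (tp 2 3) (tp 3 4) \<in> free_lie (gens 4 - {T1 4})"
    "subst3 \<psi> (t1 2 + t1 3 + tp 2 3 + tm 2 3) (tp 2 4 + tp 3 4) (tm 2 4 + tm 3 4)
      \<in> free_lie (gens 4 - {T1 4})"
    "subst3 \<psi> (t1 2) (tp 2 3) (tm 2 3) \<in> free_lie (gens 4 - {T1 4})"
    by (auto intro!: subst2_free_lie subst3_free_lie assms lie_poly.add
        simp: hom_part_add hom_part_var[simplified])
  show "?l \<in> t0_alg 4" "?r \<in> t0_alg 4"
    unfolding t0_alg_def by (intro imageI free_lie_add *)+
qed

end

(* The signed permutations of the strands 2, 3, 4 act on t_{4,2}, so the mixed pentagon equation may be
   renumbered. An alternating sum of six such equations says that the octagon defect G of psi satisfies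
   G(t12, t23 + t24) = G(t12, t23) + G(t12 + t23, t24) up to values of phi, where the last argument of
   each octagon is left out. Apply this identity to a vector of a small graded representation of t_{4,2},
   in which t24 detects the last letter of a word: in degree n + 1 it says that the right quotient of G
   by the letter B(0) is a combination of (A + B(0) + B(1))^n and B(0)^n. But G is antisymmetric both
   under exchanging B(0) and B(1) and under exchanging A and C, and for n >= 2 this forces G = 0. In
   degree 2, two of the pentagon equations and c_{AB(0)} = 0 give psi = 0; in degree 1, G vanishes
   for every psi. *)

theory Submission
  imports Defs "HOL-Library.Product_Plus"
begin

section \<open>Evaluation of series in an algebra\<close>

text \<open>An identity in the quotient t_{4,2} gives information on coefficients only through maps
  out of it; a concrete representation yields such a map without any basis or normal form for
  t_{4,2}. The price is that only the right quotient by B(0) becomes visible, because t^{24}_- acts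
  as 0. Antisymmetry under B(0) <-> B(1) recovers the quotient by B(1), and antisymmetry under A <->
  C recovers the quotient by A from either of these two. The two results for A have opposite signs,
  and it is their agreement that forces G = 0. Degree 2 is an obstacle and not just an induction
  start: [A, B(0)] - [A, B(1)] + [B(1), B(0)] has both antisymmetries, and its right quotient by
  B(0) is (A + B(0) + B(1)) - B(0), so it passes every test used in higher degrees. This is where
  the coefficient of AB(0) has to be prescribed.\<close>

definition words :: "'x set \<Rightarrow> nat \<Rightarrow> 'x list set"
  where "words S d = {w \<in> lists S. length w = d}"

lemma finite_words: "finite S \<Longrightarrow> finite (words S d)"
  using finite_lists_length_eq[of S d] by (simp add: words_def lists_eq_set)

lemma words_UNIV: "words UNIV d = {w. length w = d}"
  by (simp add: words_def)

lemma sum_words_split: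
  assumes "i \<le> d"
  shows "(\<Sum>w\<in>words S d. h (take i w) (drop i w)) = (\<Sum>u\<in>words S i. \<Sum>v\<in>words S (d - i). h u v)"
proof -
  have "(\<Sum>w\<in>words S d. h (take i w) (drop i w)) = (\<Sum>(u, v)\<in>words S i \<times> words S (d - i). h u v)"
    by (rule sum.reindex_bij_witness[where i = "\<lambda>(u, v). u @ v" and j = "\<lambda>w. (take i w, drop i w)"])
      (use assms in \<open>auto simp: words_def dest: in_set_takeD in_set_dropD\<close>)
  then show ?thesis
    by (simp add: sum.cartesian_product)
qed

abbreviation (input) mixed_pentagon :: "(ab, 'k::field) ncps \<Rightarrow> (ab3, 'k) ncps \<Rightarrow> bool"
  where "mixed_pentagon \<phi> \<psi> \<equiv>
    t_class 4
      (subst3 \<psi> (t1 2) (tp 2 3 + tp 2 4) (tm 2 3 + tm 2 4)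
       + subst3 \<psi> (t1 3 + tp 2 3 + tm 2 3) (tp 3 4) (tm 3 4))
    = t_class 4
      (subst2 \<phi> (tp 2 3) (tp 3 4)
       + subst3 \<psi> (t1 2 + t1 3 + tp 2 3 + tm 2 3) (tp 2 4 + tp 3 4) (tm 2 4 + tm 3 4)
       + subst3 \<psi> (t1 2) (tp 2 3) (tm 2 3))"

text \<open>The class \<open>ring_1\<close> would demand 0 \<noteq> 1, which fails for the
  endomorphisms of a trivial group; hence the sort \<open>{ring, monoid_mult}\<close>. The image of
  \<open>\<kappa>\<close> need not be central, since the endomorphisms used later are merely
  additive; \<open>commutes\<close> singles out the linear ones.\<close>

locale scalars =
  fixes \<kappa> :: "'k::field \<Rightarrow> 'r::{ring,monoid_mult}"
  assumes \<kappa>_add: "\<kappa> (a + b) = \<kappa> a + \<kappa> b"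
    and \<kappa>_mult: "\<kappa> (a * b) = \<kappa> a * \<kappa> b"
    and \<kappa>_one: "\<kappa> 1 = 1"
begin

lemma \<kappa>_zero: "\<kappa> 0 = 0"
  using \<kappa>_add[of 0 0] by simp

lemma \<kappa>_diff: "\<kappa> (a - b) = \<kappa> a - \<kappa> b"
  using \<kappa>_add[of "a - b" b] by (simp add: algebra_simps)

lemma \<kappa>_sum: "\<kappa> (sum h I) = (\<Sum>i\<in>I. \<kappa> (h i))"
  by (induction I rule: infinite_finite_induct) (auto simp: \<kappa>_zero \<kappa>_add)

definition commutes :: "'r \<Rightarrow> bool"
  where "commutes x \<longleftrightarrow> (\<forall>c. \<kappa> c * x = x * \<kappa> c)"

lemma commutes_mult: "commutes x \<Longrightarrow> commutes y \<Longrightarrow> commutes (x * y)"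
  unfolding commutes_def by (metis mult.assoc)

lemma commutes_prod_list: "(\<And>x. x \<in> set xs \<Longrightarrow> commutes x) \<Longrightarrow> commutes (prod_list xs)"
  by (induction xs) (auto simp: commutes_mult, simp add: commutes_def)

lemma commutes_add: "commutes x \<Longrightarrow> commutes y \<Longrightarrow> commutes (x + y)"
  by (simp add: commutes_def algebra_simps)

lemma commutes_diff: "commutes x \<Longrightarrow> commutes y \<Longrightarrow> commutes (x - y)"
  by (simp add: commutes_def algebra_simps)

lemma commutes_uminus: "commutes x \<Longrightarrow> commutes (- x)"
  by (simp add: commutes_def)

lemma commutes_zero: "commutes 0"
  by (simp add: commutes_def)

lemma commutes_sum: "(\<And>i. i \<in> I \<Longrightarrow> commutes (h i)) \<Longrightarrow> commutes (sum h I)"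
  by (induction I rule: infinite_finite_induct) (auto simp: commutes_zero commutes_add)

lemma commutes_\<kappa>: "commutes (\<kappa> c)"
  unfolding commutes_def by (metis \<kappa>_mult mult.commute)

text \<open>A series has no value in a ring without topology, so evaluation is done one degree at a
  time.\<close>

definition eval :: "'x set \<Rightarrow> ('x \<Rightarrow> 'r) \<Rightarrow> nat \<Rightarrow> ('x, 'k) ncps \<Rightarrow> 'r"
  where "eval S \<rho> d f = (\<Sum>w\<in>words S d. \<kappa> (coeff f w) * prod_list (map \<rho> w))"

lemma eval_add: "eval S \<rho> d (f + g) = eval S \<rho> d f + eval S \<rho> d g"
  by (simp add: eval_def \<kappa>_add distrib_right sum.distrib)

lemma eval_diff: "eval S \<rho> d (f - g) = eval S \<rho> d f - eval S \<rho> d g"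
  by (simp add: eval_def \<kappa>_diff left_diff_distrib sum_subtractf)

lemma eval_scale: "eval S \<rho> d (scale c f) = \<kappa> c * eval S \<rho> d f"
  by (simp add: eval_def \<kappa>_mult sum_distrib_left mult.assoc)

lemma eval_zero: "eval S \<rho> d 0 = 0"
  by (simp add: eval_def \<kappa>_zero)

lemma eval_sum: "eval S \<rho> d (sum h I) = (\<Sum>i\<in>I. eval S \<rho> d (h i))"
  by (induction I rule: infinite_finite_induct) (auto simp: eval_zero eval_add)

lemma eval_hom_part: "eval S \<rho> d (hom_part d f) = eval S \<rho> d f"
  by (auto simp: eval_def coeff_hom_part words_def intro!: sum.cong)

lemma eval_linear_eq_zero: "hom_part 1 f = f \<Longrightarrow> d \<noteq> 1 \<Longrightarrow> eval S \<rho> d f = 0"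
  unfolding eval_def
  by (rule sum.neutral) (metis (mono_tags, lifting) \<kappa>_zero coeff_hom_part mem_Collect_eq mult_zero_left words_def)

lemma eval_one: "eval S \<rho> 0 1 = 1"
  by (simp add: eval_def words_def coeff_one \<kappa>_one cong: conj_cong)

lemma eval_var:
  assumes "finite S" "x \<in> S"
  shows "eval S \<rho> 1 (var x) = \<rho> x"
proof -
  have "eval S \<rho> 1 (var x) = (\<Sum>w\<in>words S 1. if w = [x] then \<rho> x else 0)"
    unfolding eval_def by (intro sum.cong refl) (auto simp: coeff_var \<kappa>_one \<kappa>_zero)
  also have "\<dots> = \<rho> x"
    using assms by (simp add: finite_words) (simp add: words_def)
  finally show ?thesis .
qed

context
  fixes S :: "'x set" and \<rho> :: "'x \<Rightarrow> 'r"
  assumes finite: "finite S" and commutes: "\<And>x. x \<in> S \<Longrightarrow> commutes (\<rho> x)"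
begin

lemma commutes_word: "w \<in> words S d \<Longrightarrow> commutes (prod_list (map \<rho> w))"
  by (rule commutes_prod_list) (auto simp: words_def commutes)

lemma eval_mult: "eval S \<rho> d (f * g) = (\<Sum>i\<le>d. eval S \<rho> i f * eval S \<rho> (d - i) g)"
proof -
  let ?P = "\<lambda>w. prod_list (map \<rho> w)"
  have "eval S \<rho> d (f * g)
      = (\<Sum>w\<in>words S d. \<Sum>i\<le>d. \<kappa> (coeff f (take i w)) * \<kappa> (coeff g (drop i w)) * (?P (take i w) * ?P (drop i w)))"
    unfolding eval_def
  proof (intro sum.cong refl)
    fix w assume w: "w \<in> words S d"
    have "?P w = ?P (take i w) * ?P (drop i w)" for i
      by (metis append_take_drop_id map_append prod_list.append)
    with w show "\<kappa> (coeff (f * g) w) * ?P w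
        = (\<Sum>i\<le>d. \<kappa> (coeff f (take i w)) * \<kappa> (coeff g (drop i w)) * (?P (take i w) * ?P (drop i w)))"
      by (simp add: coeff_mult \<kappa>_sum \<kappa>_mult sum_distrib_right words_def)
  qed
  also have "\<dots> = (\<Sum>i\<le>d. \<Sum>w\<in>words S d. \<kappa> (coeff f (take i w)) * \<kappa> (coeff g (drop i w)) * (?P (take i w) * ?P (drop i w)))"
    by (rule sum.swap)
  also have "\<dots> = (\<Sum>i\<le>d. eval S \<rho> i f * eval S \<rho> (d - i) g)"
  proof (intro sum.cong refl)
    fix i assume "i \<in> {..d}"
    then have "(\<Sum>w\<in>words S d. \<kappa> (coeff f (take i w)) * \<kappa> (coeff g (drop i w)) * (?P (take i w) * ?P (drop i w)))
      = (\<Sum>u\<in>words S i. \<Sum>v\<in>words S (d - i). \<kappa> (coeff f u) * \<kappa> (coeff g v) * (?P u * ?P v))"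
      by (intro sum_words_split) simp
    also have "\<dots> = (\<Sum>u\<in>words S i. \<Sum>v\<in>words S (d - i). (\<kappa> (coeff f u) * ?P u) * (\<kappa> (coeff g v) * ?P v))"
    proof (intro sum.cong refl)
      fix u v assume "u \<in> words S i"
      then have "\<kappa> (coeff g v) * ?P u = ?P u * \<kappa> (coeff g v)"
        using commutes_word by (auto simp: commutes_def)
      then show "\<kappa> (coeff f u) * \<kappa> (coeff g v) * (?P u * ?P v)
          = (\<kappa> (coeff f u) * ?P u) * (\<kappa> (coeff g v) * ?P v)"
        by (metis mult.assoc)
    qed
    finally show "(\<Sum>w\<in>words S d. \<kappa> (coeff f (take i w)) * \<kappa> (coeff g (drop i w)) * (?P (take i w) * ?P (drop i w)))
      = eval S \<rho> i f * eval S \<rho> (d - i) g"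
      by (simp add: eval_def sum_product)
  qed
  finally show ?thesis .
qed

lemma eval_linear_mult:
  assumes "hom_part 1 f = f"
  shows "eval S \<rho> (Suc d) (f * g) = eval S \<rho> 1 f * eval S \<rho> d g"
proof -
  have "eval S \<rho> (Suc d) (f * g) = (\<Sum>i\<le>Suc d. if i = 1 then eval S \<rho> 1 f * eval S \<rho> d g else 0)"
    unfolding eval_mult by (intro sum.cong refl) (auto simp: eval_linear_eq_zero[OF assms, simplified])
  then show ?thesis
    by simp
qed

lemma eval_linear_bracket_eq_zero:
  assumes f: "hom_part 1 f = f" and g: "hom_part 1 g = g"
    and "eval S \<rho> 1 f * eval S \<rho> 1 g = eval S \<rho> 1 g * eval S \<rho> 1 f"
  shows "eval S \<rho> d (bracket f g) = 0"
proof (cases d)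
  case 0
  then show ?thesis
    by (simp add: bracket_def eval_diff eval_mult eval_linear_eq_zero[OF f] eval_linear_eq_zero[OF g])
next
  case (Suc e)
  then show ?thesis
    using assms by (cases "e = 1")
      (simp_all add: bracket_def eval_diff eval_linear_mult eval_linear_eq_zero[OF f, simplified]
        eval_linear_eq_zero[OF g, simplified])
qed

lemma eval_subst:
  fixes \<sigma> :: "'z::finite \<Rightarrow> ('x, 'k) ncps"
  assumes hom: "\<And>x. hom_part 1 (\<sigma> x) = \<sigma> x"
  shows "eval S \<rho> d (subst \<sigma> f) = eval UNIV (\<lambda>x. eval S \<rho> 1 (\<sigma> x)) d f"
proof -
  have word: "eval S \<rho> (length w) (prod_list (map \<sigma> w)) = prod_list (map (\<lambda>x. eval S \<rho> 1 (\<sigma> x)) w)" for w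
    by (induction w) (simp_all add: eval_one eval_linear_mult[OF hom, simplified])
  have "eval S \<rho> d (subst \<sigma> f) = (\<Sum>v\<in>words S d. \<Sum>w\<in>words UNIV d.
      \<kappa> (coeff f w) * (\<kappa> (coeff (prod_list (map \<sigma> w)) v) * prod_list (map \<rho> v)))"
    unfolding eval_def
    by (intro sum.cong refl)
      (simp add: words_def coeff_subst_hom[OF hom] \<kappa>_sum \<kappa>_mult sum_distrib_right mult.assoc)
  also have "\<dots> = (\<Sum>w\<in>words UNIV d. \<kappa> (coeff f w) * eval S \<rho> d (prod_list (map \<sigma> w)))"
    by (subst sum.swap) (simp add: eval_def sum_distrib_left)
  also have "\<dots> = eval UNIV (\<lambda>x. eval S \<rho> 1 (\<sigma> x)) d f"
    unfolding eval_def[of UNIV] using word by (intro sum.cong refl) (auto simp: words_UNIV)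
  finally show ?thesis .
qed

end

definition eval2 :: "nat \<Rightarrow> (ab, 'k) ncps \<Rightarrow> 'r \<Rightarrow> 'r \<Rightarrow> 'r"
  where "eval2 d f X Y = eval UNIV (case_ab X Y) d f"

definition eval3 :: "nat \<Rightarrow> (ab3, 'k) ncps \<Rightarrow> 'r \<Rightarrow> 'r \<Rightarrow> 'r \<Rightarrow> 'r"
  where "eval3 d f X Y0 Y1 = eval UNIV (case_ab3 X (case_bit Y0 Y1)) d f"

lemma eval_subst2:
  assumes "finite S" "\<And>x. x \<in> S \<Longrightarrow> commutes (\<rho> x)"
    and "hom_part 1 X = X" "hom_part 1 Y = Y"
  shows "eval S \<rho> d (subst2 f X Y) = eval2 d f (eval S \<rho> 1 X) (eval S \<rho> 1 Y)"
proof -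
  have "hom_part 1 (case_ab X Y x) = case_ab X Y x" for x
    using assms by (cases x) auto
  moreover have "(\<lambda>x. eval S \<rho> 1 (case_ab X Y x)) = case_ab (eval S \<rho> 1 X) (eval S \<rho> 1 Y)"
    by (auto split: ab.split)
  ultimately show ?thesis
    using eval_subst[of S \<rho> "case_ab X Y" d f, OF assms(1,2)] by (simp add: subst2_def eval2_def)
qed

lemma eval_subst3:
  assumes "finite S" "\<And>x. x \<in> S \<Longrightarrow> commutes (\<rho> x)"
    and "hom_part 1 X = X" "hom_part 1 Y0 = Y0" "hom_part 1 Y1 = Y1"
  shows "eval S \<rho> d (subst3 f X Y0 Y1) = eval3 d f (eval S \<rho> 1 X) (eval S \<rho> 1 Y0) (eval S \<rho> 1 Y1)"
proof -
  have "hom_part 1 (case_ab3 X (case_bit Y0 Y1) x) = case_ab3 X (case_bit Y0 Y1) x" for x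
    using assms by (auto split: ab3.split bit.split)
  moreover have "(\<lambda>x. eval S \<rho> 1 (case_ab3 X (case_bit Y0 Y1) x))
      = case_ab3 (eval S \<rho> 1 X) (case_bit (eval S \<rho> 1 Y0) (eval S \<rho> 1 Y1))"
    by (auto split: ab3.split bit.split)
  ultimately show ?thesis
    using eval_subst[of S \<rho> "case_ab3 X (case_bit Y0 Y1)" d f, OF assms(1,2)]
    by (simp add: subst3_def eval3_def)
qed


section \<open>Representations of t_{n,2}\<close>

definition comm :: "'r \<Rightarrow> 'r \<Rightarrow> 'r"
  where "comm x y = x * y - y * x"

text \<open>The images of t^{1i} and t(a)^{ij} under a representation of t_{n,2}. Since -a = a in
  Z/2, the symmetry relation takes the form \<open>q a i j = q a j i\<close>.\<close>

definition t_rep :: "nat \<Rightarrow> (nat \<Rightarrow> 'r) \<Rightarrow> (bit \<Rightarrow> nat \<Rightarrow> nat \<Rightarrow> 'r) \<Rightarrow> bool"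
  where "t_rep n p q \<longleftrightarrow>
    (\<forall>i\<in>{2..n}. commutes (p i)) \<and>
    (\<forall>i j a. {i, j} \<subseteq> {2..n} \<longrightarrow> i \<noteq> j \<longrightarrow>
      commutes (q a i j) \<and> q a i j = q a j i
      \<and> comm (p i + p j + (\<Sum>c\<in>UNIV. q c i j)) (q a i j) = 0
      \<and> comm (p i) (p j + (\<Sum>c\<in>UNIV. q c i j)) = 0) \<and>
    (\<forall>i j k a b. {i, j, k} \<subseteq> {2..n} \<longrightarrow> distinct [i, j, k] \<longrightarrow>
      comm (q a i j) (q (a + b) i k + q b j k) = 0 \<and> comm (p i) (q a j k) = 0) \<and>
    (\<forall>i j k l a b. {i, j, k, l} \<subseteq> {2..n} \<longrightarrow> distinct [i, j, k, l] \<longrightarrow> comm (q a i j) (q b k l) = 0)"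


lemma finite_gens: "finite (gens n)"
proof -
  have "{T a i j | a i j. i \<in> {2..n} \<and> j \<in> {2..n} \<and> i \<noteq> j}
      \<subseteq> (\<lambda>(a, i, j). T a i j) ` (UNIV \<times> {2..n} \<times> {2..n})"
    by force
  then have "finite {T a i j | a i j. i \<in> {2..n} \<and> j \<in> {2..n} \<and> i \<noteq> j}"
    by (rule finite_subset) auto
  then show ?thesis
    by (simp add: gens_def)
qed

context
  fixes n p q
  assumes rep: "t_rep n p q"
begin

lemma commutes_gen: "x \<in> gens n \<Longrightarrow> commutes (case_gen p q x)"
  using rep by (auto simp: gens_def t_rep_def)

lemma eval_t1: "i \<in> {2..n} \<Longrightarrow> eval (gens n) (case_gen p q) 1 (t1 i) = p i"
  by (subst eval_var) (auto simp: finite_gens, auto simp: gens_def)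

lemma eval_ta: "i \<in> {2..n} \<Longrightarrow> j \<in> {2..n} \<Longrightarrow> i \<noteq> j \<Longrightarrow> eval (gens n) (case_gen p q) 1 (ta a i j) = q a i j"
  by (subst eval_var) (auto simp: finite_gens, auto simp: gens_def)

lemma hom_part_sum: "hom_part d (sum h I) = (\<Sum>i\<in>I. hom_part d (h i))"
  by (induction I rule: infinite_finite_induct) (auto simp: hom_part_add ncps_eq_iff coeff_hom_part)

lemma eval_rels: "f \<in> rels n \<Longrightarrow> eval (gens n) (case_gen p q) d f = 0"
proof (induction rule: rels.induct)
  case (sym i j a)
  have "hom_part 1 (ta a i j - ta (- a) j i) = (ta a i j - ta (- a) j i :: (gen, 'k) ncps)"
    by (auto simp: ncps_eq_iff coeff_hom_part coeff_var)
  moreover have "- a = a"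
    by (cases a) auto
  ultimately show ?case
  proof (cases "d = 1")
    case True
    with rep sym \<open>- a = a\<close> show ?thesis
      by (simp add: eval_diff eval_ta[simplified]) (simp add: t_rep_def)
  qed (simp add: eval_linear_eq_zero)
next
  case (infinitesimal i j k a b)
  then show ?case
    using rep by (intro eval_linear_bracket_eq_zero commutes_gen finite_gens)
     (auto simp: hom_part_add hom_part_var[simplified] eval_add eval_ta[simplified] t_rep_def comm_def)
next
  case (central i j a)
  then show ?case
    using rep by (intro eval_linear_bracket_eq_zero commutes_gen finite_gens)
     (auto simp: hom_part_add hom_part_sum hom_part_var[simplified] eval_add eval_sum
       eval_ta[simplified] eval_t1[simplified] t_rep_def comm_def)
next
  case (mixed i j)
  then show ?case
    using rep by (intro eval_linear_bracket_eq_zero commutes_gen finite_gens)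
     (auto simp: hom_part_add hom_part_sum hom_part_var[simplified] eval_add eval_sum
       eval_ta[simplified] eval_t1[simplified] t_rep_def comm_def)
next
  case (comm1 i j k a)
  then show ?case
    using rep by (intro eval_linear_bracket_eq_zero commutes_gen finite_gens)
     (auto simp: hom_part_var[simplified] eval_ta[simplified] eval_t1[simplified] t_rep_def comm_def)
next
  case (comm i j k l a b)
  then show ?case
    using rep by (intro eval_linear_bracket_eq_zero commutes_gen finite_gens)
     (auto simp: hom_part_var[simplified] eval_ta[simplified] t_rep_def comm_def)
qed

text \<open>The induction needs all degrees at once: the value of a bracket in degree
  \<open>d\<close> is a convolution over the values of \<open>g\<close> in all degrees up to
  \<open>d\<close>.\<close>

lemma eval_lie_ideal: "f \<in> lie_ideal L (rels n) \<Longrightarrow> eval (gens n) (case_gen p q) d f = 0"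
proof (induction arbitrary: d rule: lie_ideal.induct)
  case (bracket f g)
  then show ?case
    by (simp add: bracket_def eval_diff eval_mult[OF finite_gens commutes_gen])
qed (simp_all add: eval_rels eval_zero eval_add eval_scale)

lemma eval_t_class_eq:
  assumes "t_class n f = t_class n g"
  shows "eval (gens n) (case_gen p q) d f = eval (gens n) (case_gen p q) d g"
proof -
  have "hom_part e 0 = (0 :: (gen, 'k) ncps)" for e
    by (auto simp: ncps_eq_iff coeff_hom_part)
  then have "(0 :: (gen, 'k) ncps) \<in> t_ideal n"
    by (simp add: t_ideal_def completion_def lie_ideal.zero)
  then have "f - g \<in> t_ideal n"
    using assms by (auto simp: t_class_def)
  \<comment> \<open>\<open>t_ideal\<close> is a completion, so it is the homogeneous components of
    \<open>f - g\<close> that lie in the ideal; the value in degree \<open>d\<close> sees just one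
    of them.\<close>
  then have "eval (gens n) (case_gen p q) d (hom_part d (f - g)) = 0"
    by (auto simp: t_ideal_def completion_def intro: eval_lie_ideal)
  then show ?thesis
    by (simp add: eval_hom_part eval_diff)
qed

end

section \<open>The pentagon equation under signed permutations of the strands\<close>

definition pentagon_defect ::
  "nat \<Rightarrow> (ab, 'k) ncps \<Rightarrow> (ab3, 'k) ncps \<Rightarrow> (nat \<Rightarrow> 'r) \<Rightarrow> (bit \<Rightarrow> nat \<Rightarrow> nat \<Rightarrow> 'r)
    \<Rightarrow> nat \<Rightarrow> nat \<Rightarrow> nat \<Rightarrow> 'r" where
  "pentagon_defect d \<phi> \<psi> p q i j k =
     eval3 d \<psi> (p i) (q 0 i j + q 0 i k) (q 1 i j + q 1 i k)
     + eval3 d \<psi> (p j + q 0 i j + q 1 i j) (q 0 j k) (q 1 j k)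
     - eval2 d \<phi> (q 0 i j) (q 0 j k)
     - eval3 d \<psi> (p i + p j + q 0 i j + q 1 i j) (q 0 i k + q 0 j k) (q 1 i k + q 1 j k)
     - eval3 d \<psi> (p i) (q 0 i j) (q 1 i j)"

lemma pentagon_defect_eq_zero:
  assumes rep: "t_rep 4 p q"
    and "mixed_pentagon \<phi> \<psi>"
  shows "pentagon_defect d \<phi> \<psi> p q 2 3 4 = 0"
  using eval_t_class_eq[OF rep assms(2), of d]
  by (simp add: pentagon_defect_def eval_add eval_subst2[OF finite_gens commutes_gen[OF rep]]
    eval_subst3[OF finite_gens commutes_gen[OF rep]] hom_part_add hom_part_var[simplified]
    eval_ta[OF rep, simplified] eval_t1[OF rep, simplified] algebra_simps)

lemma sum_bit: "(\<Sum>c\<in>UNIV. h c) = h 0 + h (1 :: bit)"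
proof -
  have "(UNIV :: bit set) = {0, 1}"
    using bit.exhaust by auto
  then show ?thesis
    by (simp only: \<open>UNIV = _\<close>) simp
qed

text \<open>Flipping the sign of a strand shifts the \<open>a\<close> of every t(a)^{ij} at that
  strand by 1. Sums over all \<open>c\<close> are invariant under shifts, and in the three-strand
  relation the sign of strand \<open>j\<close> enters twice and drops out, which is
  \<open>shift\<close>.\<close>

lemma t_rep_signed_perm:
  assumes rep: "t_rep n p q" and inj: "inj_on \<pi> {2..n}" and \<pi>: "\<And>i. i \<in> {2..n} \<Longrightarrow> \<pi> i \<in> {2..n}"
  shows "t_rep n (\<lambda>i. p (\<pi> i)) (\<lambda>a i j. q (a + \<epsilon> i + \<epsilon> j) (\<pi> i) (\<pi> j))"
proof -
  have sum: "(\<Sum>c\<in>UNIV. h (c + e + e')) = (\<Sum>c\<in>UNIV. h c)" for h :: "bit \<Rightarrow> 'r" and e e'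
    by (cases e; cases e') (simp_all add: sum_bit add.commute)
  have distinct: "\<pi> i \<noteq> \<pi> j" if "i \<in> {2..n}" "j \<in> {2..n}" "i \<noteq> j" for i j
    using inj that by (auto dest: inj_onD)
  have shift: "x + y + e + z = (x + e + e') + (y + e' + z)" for x y e e' z :: bit
  proof -
    have "e' + e' = 0"
      by (cases e') simp_all
    have "(x + e + e') + (y + e' + z) = x + (e + (e' + (y + (e' + z))))"
      by (simp only: add.assoc)
    also have "\<dots> = x + (y + (e + (e' + e' + z)))"
      by (simp only: add.left_commute add.assoc)
    also have "\<dots> = x + y + e + z"
      by (simp only: \<open>e' + e' = 0\<close> add.assoc add_0_left)
    finally show ?thesis
      by (rule HOL.sym)
  qed
  note rels = rep[unfolded t_rep_def]
  note p = rels[THEN conjunct1, rule_format]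
    and q2 = rels[THEN conjunct2, THEN conjunct1, rule_format]
    and q3 = rels[THEN conjunct2, THEN conjunct2, THEN conjunct1, rule_format]
    and q4 = rels[THEN conjunct2, THEN conjunct2, THEN conjunct2, rule_format]
  show ?thesis
    unfolding t_rep_def
  proof (intro conjI allI impI ballI)
    fix i j a assume ij: "{i, j} \<subseteq> {2..n}" "i \<noteq> j"
    then have *: "{\<pi> i, \<pi> j} \<subseteq> {2..n}" "\<pi> i \<noteq> \<pi> j"
      using \<pi>[of i] \<pi>[of j] distinct[of i j] by simp_all
    show "commutes (q (a + \<epsilon> i + \<epsilon> j) (\<pi> i) (\<pi> j))"
      and "comm (p (\<pi> i) + p (\<pi> j) + (\<Sum>c\<in>UNIV. q (c + \<epsilon> i + \<epsilon> j) (\<pi> i) (\<pi> j))) (q (a + \<epsilon> i + \<epsilon> j) (\<pi> i) (\<pi> j)) = 0"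
      and "comm (p (\<pi> i)) (p (\<pi> j) + (\<Sum>c\<in>UNIV. q (c + \<epsilon> i + \<epsilon> j) (\<pi> i) (\<pi> j))) = 0"
      unfolding sum[of "\<lambda>c. q c (\<pi> i) (\<pi> j)"] using q2[OF *] by blast+
    show "q (a + \<epsilon> i + \<epsilon> j) (\<pi> i) (\<pi> j) = q (a + \<epsilon> j + \<epsilon> i) (\<pi> j) (\<pi> i)"
      using q2[OF *, of "a + \<epsilon> i + \<epsilon> j"] by (metis add.assoc add.commute)
  next
    fix i j k a b assume ijk: "{i, j, k} \<subseteq> {2..n}" "distinct [i, j, k]"
    then have *: "{\<pi> i, \<pi> j, \<pi> k} \<subseteq> {2..n}" "distinct [\<pi> i, \<pi> j, \<pi> k]"
      using \<pi>[of i] \<pi>[of j] \<pi>[of k] distinct[of i j] distinct[of i k] distinct[of j k] by simp_all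
    show "comm (q (a + \<epsilon> i + \<epsilon> j) (\<pi> i) (\<pi> j)) (q (a + b + \<epsilon> i + \<epsilon> k) (\<pi> i) (\<pi> k) + q (b + \<epsilon> j + \<epsilon> k) (\<pi> j) (\<pi> k)) = 0"
      unfolding shift[of a b "\<epsilon> i" "\<epsilon> k" "\<epsilon> j"] using q3[OF *] by blast
    show "comm (p (\<pi> i)) (q (a + \<epsilon> j + \<epsilon> k) (\<pi> j) (\<pi> k)) = 0"
      using q3[OF *] by blast
  next
    fix i j k l a b assume ijkl: "{i, j, k, l} \<subseteq> {2..n}" "distinct [i, j, k, l]"
    show "comm (q (a + \<epsilon> i + \<epsilon> j) (\<pi> i) (\<pi> j)) (q (b + \<epsilon> k + \<epsilon> l) (\<pi> k) (\<pi> l)) = 0"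
      by (rule q4)
        (use ijkl \<pi>[of i] \<pi>[of j] \<pi>[of k] \<pi>[of l] distinct[of i j] distinct[of i k] distinct[of i l]
          distinct[of j k] distinct[of j l] distinct[of k l] in simp_all)
  qed (use p \<pi> in simp)
qed

text \<open>The relabelling acts on the representation instead of the equation: the given pentagon
  equation, read in the transported representation, is the one for the strands \<open>i\<close>,
  \<open>j\<close>, \<open>k\<close> with signs \<open>\<epsilon>\<close>.\<close>

lemma pentagon_defect_signed_perm_eq_zero:
  assumes "t_rep 4 p q"
    and "mixed_pentagon \<phi> \<psi>"
    and "{i, j, k} = {2, 3, 4}" "distinct [i, j, k]"
  shows "pentagon_defect d \<phi> \<psi> p (\<lambda>a i j. q (a + \<epsilon> i + \<epsilon> j) i j) i j k = 0"
proof -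
  \<comment> \<open>The default \<open>i\<close> serves as the value at 2 and keeps all values of
    \<open>\<pi>\<close> in {i, j, k}.\<close>
  define \<pi> :: "nat \<Rightarrow> nat" where "\<pi> = (\<lambda>_. i)(3 := j, 4 := k)"
  have *: "{2..4} = {2, 3, 4 :: nat}"
    by auto
  have "t_rep 4 (\<lambda>i. p (\<pi> i)) (\<lambda>a i j. q (a + \<epsilon> (\<pi> i) + \<epsilon> (\<pi> j)) (\<pi> i) (\<pi> j))"
  proof (rule t_rep_signed_perm[OF assms(1), of \<pi> "\<lambda>i. \<epsilon> (\<pi> i)"])
    show "inj_on \<pi> {2..4}"
      using assms(4) by (simp add: * \<pi>_def inj_on_def)
    have "\<pi> m \<in> {i, j, k}" for m
      by (simp add: \<pi>_def)
    then show "\<pi> m \<in> {2..4}" for m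
      by (simp only: assms(3) *)
  qed
  from pentagon_defect_eq_zero[OF this assms(2)] show ?thesis
    unfolding pentagon_defect_def \<pi>_def fun_upd_def by simp
qed

text \<open>\<open>Z\<close> stands for C. It is a separate argument because t^{12} + t^{13} +
  t^{23}_+ + t^{23}_- is central on the strands 1, 2, 3 but not 0: t^{13} takes the place of C
  without being \<open>- X - Y0 - Y1\<close>.\<close>

definition octagon :: "nat \<Rightarrow> (ab3, 'k) ncps \<Rightarrow> 'r \<Rightarrow> 'r \<Rightarrow> 'r \<Rightarrow> 'r \<Rightarrow> 'r" where
  "octagon d f X Y0 Y1 Z = eval3 d f X Y0 Y1 - eval3 d f X Y1 Y0 + eval3 d f Z Y1 Y0 - eval3 d f Z Y0 Y1"

text \<open>The alternating sum of the pentagon equations for the signed triples $(2,3,4)$, $(-2,3,4)$,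
  $(-3,-4,2)$, $(3,4,2)$, $(3,2,4)$, $(3,-2,4)$, in which most terms cancel.\<close>

lemma octagon_doubling:
  assumes rep: "t_rep 4 p q"
    and pentagon: "mixed_pentagon \<phi> \<psi>"
  shows "octagon d \<psi> (p 2) (q 0 2 3 + q 0 2 4) (q 1 2 3 + q 1 2 4) (p 3 + p 4 + q 0 3 4 + q 1 3 4)
    = octagon d \<psi> (p 2) (q 0 2 3) (q 1 2 3) (p 3)
      + octagon d \<psi> (p 2 + q 0 2 3 + q 1 2 3) (q 0 2 4) (q 1 2 4) (p 4 + q 0 3 4 + q 1 3 4)
      + eval2 d \<phi> (q 0 2 3) (q 0 3 4) - eval2 d \<phi> (q 1 2 3) (q 0 3 4)
      + eval2 d \<phi> (q 0 3 4) (q 0 2 4) - eval2 d \<phi> (q 0 3 4) (q 1 2 4)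
      + eval2 d \<phi> (q 1 2 3) (q 1 2 4) - eval2 d \<phi> (q 0 2 3) (q 0 2 4)"
proof -
  define E where "E i j k s = pentagon_defect d \<phi> \<psi> p (\<lambda>a i j. q (a + s i + s j) i j) i j k" for i j k s
  let ?z = "\<lambda>_ :: nat. 0 :: bit"
  have sym: "q a 3 2 = q a 2 3" "q a 4 2 = q a 2 4" "q a 4 3 = q a 3 4" for a
    using rep by (auto simp: t_rep_def)
  have *: "E i j k s = 0" if "{i, j, k} = {2, 3, 4}" "distinct [i, j, k]" for i j k s
    unfolding E_def by (rule pentagon_defect_signed_perm_eq_zero[OF rep pentagon that])
  have perms: "{2, 3, 4} = {2, 3, 4 :: nat}" "{3, 4, 2} = {2, 3, 4 :: nat}" "{3, 2, 4} = {2, 3, 4 :: nat}"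
    by auto
  \<comment> \<open>In the order of \<open>pentagon_defect\<close>, the octagon with the doubled
    strand consists of the first terms of (2,3,4) and the fourth terms of (3,4,2), with their signed
    variants; the octagon at t^{23} of the fifth terms of (2,3,4) and (3,2,4); the octagon at t^{24}
    of the second terms of (3,2,4) and (3,4,2). The other values of psi cancel in pairs.\<close>
  have "E 2 3 4 ?z - E 2 3 4 (?z(2 := 1)) - E 3 4 2 (?z(3 := 1, 4 := 1)) + E 3 4 2 ?z
      - E 3 2 4 ?z + E 3 2 4 (?z(2 := 1)) = 0"
    using *[of 2 3 4, OF perms(1)] *[of 3 4 2, OF perms(2)] *[of 3 2 4, OF perms(3)] by simp
  then show ?thesis
    unfolding E_def pentagon_defect_def octagon_def by (simp add: sym ac_simps) (simp add: algebra_simps)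
qed

end

section \<open>The algebra of additive endomorphisms\<close>

typedef (overloaded) 'a endo = "{f :: 'a::ab_group_add \<Rightarrow> 'a. \<forall>x y. f (x + y) = f x + f y}"
  morphisms app Endo
  by (rule exI[of _ id]) simp

setup_lifting type_definition_endo

lemma app_add [simp]: "app f (x + y) = app f x + app f y"
  using app[of f] by simp

lemma app_zero [simp]: "app f 0 = 0"
  using app_add[of f 0 0] by simp

lemma app_minus [simp]: "app f (- x) = - app f x"
  using app_add[of f x "- x"] by (simp add: eq_neg_iff_add_eq_0 add.commute)

lemma app_diff [simp]: "app f (x - y) = app f x - app f y"
  using app_add[of f x "- y"] by simp

instantiation endo :: (ab_group_add) "{ring, monoid_mult}"
begin

lift_definition zero_endo :: "'a endo" is "\<lambda>_. 0" by simp
lift_definition one_endo :: "'a endo" is "\<lambda>x. x" by simp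
lift_definition plus_endo :: "'a endo \<Rightarrow> 'a endo \<Rightarrow> 'a endo" is "\<lambda>f g x. f x + g x" by simp
lift_definition uminus_endo :: "'a endo \<Rightarrow> 'a endo" is "\<lambda>f x. - f x" by simp
lift_definition minus_endo :: "'a endo \<Rightarrow> 'a endo \<Rightarrow> 'a endo" is "\<lambda>f g x. f x - g x" by simp
lift_definition times_endo :: "'a endo \<Rightarrow> 'a endo \<Rightarrow> 'a endo" is "\<lambda>f g x. f (g x)" by simp

instance
  by standard (transfer; simp add: fun_eq_iff algebra_simps)+

end

lemma endo_eqI: "(\<And>x. app f x = app g x) \<Longrightarrow> f = g"
  by (metis app_inject ext)

lemma app_plus [simp]: "app (f + g) x = app f x + app g x"
  by transfer simp

lemma app_fun_diff [simp]: "app (f - g) x = app f x - app g x"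
  by transfer simp

lemma app_uminus [simp]: "app (- f) x = - app f x"
  by transfer simp

lemma app_times [simp]: "app (f * g) x = app f (app g x)"
  by transfer simp

lemma app_0 [simp]: "app 0 x = 0"
  by transfer simp

lemma app_1 [simp]: "app 1 x = x"
  by transfer simp

lemma app_sum: "app (sum h I) x = (\<Sum>i\<in>I. app (h i) x)"
  by (induction I rule: infinite_finite_induct) auto


section \<open>A representation of $\mathfrak t_{4,2}$\<close>

type_synonym 'k pair = "(ab3, 'k) ncps \<times> (ab3, 'k) ncps"

lemma coeff_uminus [simp]: "coeff (- f) w = - coeff f w"
  by transfer simp

lemma scale_mult_left: "scale c f * g = scale c (f * g)"
  by (simp add: ncps_eq_iff coeff_mult sum_distrib_left mult.assoc)

lemma scale_mult_right: "f * scale c g = scale c (f * g)" for c :: "'k::field"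
  by (simp add: ncps_eq_iff coeff_mult sum_distrib_left algebra_simps)

lemma scale_add: "scale c (f + g) = scale c f + scale c g"
  by (simp add: ncps_eq_iff algebra_simps)

lemma scale_diff: "scale c (f - g) = scale c f - scale c g"
  by (simp add: ncps_eq_iff algebra_simps)

lemma scale_zero [simp]: "scale c 0 = 0"
  by (simp add: ncps_eq_iff)

definition rquot :: "'x \<Rightarrow> ('x, 'k::ring_1) ncps \<Rightarrow> ('x, 'k) ncps"
  where "rquot x f = Abs_ncps (\<lambda>w. coeff f (w @ [x]))"

lemma coeff_rquot [simp]: "coeff (rquot x f) w = coeff f (w @ [x])"
  by (simp add: rquot_def Abs_ncps_inverse)

lemma rquot_add: "rquot x (f + g) = rquot x f + rquot x g"
  by (simp add: ncps_eq_iff)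

lemma rquot_diff: "rquot x (f - g) = rquot x f - rquot x g"
  by (simp add: ncps_eq_iff)

lemma rquot_scale: "rquot x (scale c f) = scale c (rquot x f)"
  by (simp add: ncps_eq_iff)

lemma coeff_var_mult: "coeff (var x * f) w = (case w of [] \<Rightarrow> 0 | z # v \<Rightarrow> if z = x then coeff f v else 0)"
proof (cases w)
  case (Cons z v)
  have "coeff (var x * f) w = (\<Sum>i\<le>length w. if i = 1 then (if z = x then coeff f v else 0) else 0)"
    unfolding coeff_mult
  proof (intro sum.cong refl)
    fix i assume "i \<in> {..length w}"
    then show "coeff (var x) (take i w) * coeff f (drop i w) = (if i = 1 then (if z = x then coeff f v else 0) else 0)"
      by (cases i; cases v; cases "i - 1") (auto simp: Cons coeff_var)
  qed
  with Cons show ?thesis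
    by (cases v) (simp_all add: Suc_le_eq)
qed (simp add: coeff_mult coeff_var)

lemma rquot_mult_var: "rquot x (f * var z) = (if x = z then f else 0)"
  unfolding ncps_eq_iff
proof
  fix v
  have "coeff (f * var z) (v @ [x])
      = (\<Sum>i\<le>length (v @ [x]). if i = length v then (if x = z then coeff f v else 0) else 0)"
    unfolding coeff_mult
  proof (intro sum.cong refl)
    fix i
    have "drop i (v @ [x]) = [z] \<longleftrightarrow> i = length v \<and> x = z"
      by (cases i "length v" rule: linorder_cases) (auto simp: drop_eq_Nil append_eq_Cons_conv dest: arg_cong[of _ _ length])
    then show "coeff f (take i (v @ [x])) * coeff (var z) (drop i (v @ [x]))
        = (if i = length v then (if x = z then coeff f v else 0) else 0)"
      by (simp add: coeff_var)
  qed
  then show "coeff (rquot x (f * var z)) v = coeff (if x = z then f else 0) v"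
    by simp
qed

lemma rquot_var_mult: "rquot x (var z * f) = var z * rquot x f + (if x = z then hom_part 0 f else 0)"
  by (auto simp: ncps_eq_iff coeff_var_mult coeff_hom_part split: list.split)

lemma hom_part_zero_mult: "hom_part 0 (f * g) = hom_part 0 f * hom_part 0 g"
  by (auto simp: ncps_eq_iff coeff_hom_part coeff_mult intro!: sum.neutral)

lemma hom_part_diff: "hom_part d (f - g) = hom_part d f - hom_part d g"
  by (auto simp: ncps_eq_iff coeff_hom_part)

lemma hom_part_scale: "hom_part d (scale c f) = scale c (hom_part d f)"
  by (auto simp: ncps_eq_iff coeff_hom_part)

lemma hom_part_zero_var [simp]: "hom_part 0 (var x) = 0"
  by (auto simp: ncps_eq_iff coeff_hom_part coeff_var)

lemma hom_part_zero_commute: "hom_part 0 f * g = g * hom_part 0 (f :: ('x, 'k::field) ncps)"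
proof -
  have "hom_part 0 f = scale (coeff f []) 1"
    by (auto simp: ncps_eq_iff coeff_hom_part coeff_one)
  then show ?thesis
    by (simp add: scale_mult_left scale_mult_right)
qed

text \<open>Pairs $(u, m)$ of series form a representation: $t^{12}$ and $t(s)^{23}$ are the left
  multiplications by $A$ and $B(s)$, the sum $t^{12} + t^{13} + t^{23}_+ + t^{23}_-$ is the right
  multiplication by $A + B(0) + B(1)$, the sum of all generators is $0$ and $t^{24}_- = 0$.
  The letter recorded in $m$ counts for the degree, so that $(u, m)$ is homogeneous of degree $d$ if $u$ has
  degree $d$ and $m$ has degree $d - 1$.\<close>

definition scalar :: "'k::field \<Rightarrow> 'k pair endo"
  where "scalar c = Endo (\<lambda>(u, m). (scale c u, scale c m))"

definition lmul :: "(ab3, 'k::field) ncps \<Rightarrow> 'k pair endo"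
  where "lmul x = Endo (\<lambda>(u, m). (x * u, x * m))"

definition rmul :: "(ab3, 'k::field) ncps \<Rightarrow> 'k pair endo"
  where "rmul x = Endo (\<lambda>(u, m). (u * x, m * x))"

definition op24 :: "'k::field pair endo"
  where "op24 = Endo (\<lambda>(u, m). (0, hom_part 0 u))"

text \<open>Once (1, 0) is sent to 0, the relations force the rest. That of t^{24}_+ with t(s)^{23}
  + t(s)^{34} sends (0, 1) to (0, - B(s)). Moreover t(s)^{34} must commute with left multiplication
  by A and by the other B, and with \<open>lmul (var (B s)) + op24\<close>; this carries the two
  values to all words.\<close>

definition op34 :: "bit \<Rightarrow> 'k::field pair endo"
  where "op34 s = Endo (\<lambda>(u, m). (0, (rquot (B s) u - m) * var (B s)))"

lemma app_ops [simp]: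
  "app (scalar c) v = (scale c (fst v), scale c (snd v))"
  "app (lmul x) v = (x * fst v, x * snd v)"
  "app (rmul x) v = (fst v * x, snd v * x)"
  "app op24 v = (0, hom_part 0 (fst v))"
  "app (op34 s) v = (0, (rquot (B s) (fst v) - snd v) * var (B s))"
  by (auto simp: scalar_def lmul_def rmul_def op24_def op34_def Endo_inverse hom_part_add rquot_add
    scale_add algebra_simps split_beta)

interpretation scalars scalar
proof
  fix a b :: "'k::field"
  show "scalar (a + b) = scalar a + scalar b" "scalar (a * b) = scalar a * scalar b" "scalar 1 = (1 :: 'k pair endo)"
    by (auto intro!: endo_eqI simp: ncps_eq_iff algebra_simps)
qed

lemma commutes_ops: "commutes (lmul x)" "commutes (rmul x)" "commutes op24" "commutes (op34 s)"
  unfolding commutes_def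
  by (auto intro!: endo_eqI simp: scale_mult_left scale_mult_right hom_part_scale rquot_scale scale_diff algebra_simps)

definition total :: "(ab3, 'k::field) ncps"
  where "total = var A + var (B 0) + var (B 1)"

text \<open>The element t^{12} + t^{13} + t^{23}_+ + t^{23}_- commutes with the generators on the
  strands 1, 2, 3, as the right multiplication by \<open>total\<close> does with left
  multiplications. The value at 4 is chosen to make the sum of all generators vanish.\<close>

definition op1 :: "nat \<Rightarrow> 'k::field pair endo"
  where "op1 i = (if i = 2 then lmul (var A) else if i = 3 then rmul total - lmul total
    else - rmul total - op24 - op34 0 - op34 1)"

definition op :: "bit \<Rightarrow> nat \<Rightarrow> nat \<Rightarrow> 'k::field pair endo"
  where "op s i j = (if {i, j} = {2, 3} then lmul (var (B s))
    else if {i, j} = {2, 4} then (if s = 0 then op24 else 0) else op34 s)"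

lemma lmul_add: "lmul (f + g) = lmul f + lmul g"
  by (auto intro!: endo_eqI simp: algebra_simps)

lemma hom_part_zero [simp]: "hom_part d 0 = 0"
  by (simp add: ncps_eq_iff coeff_hom_part)

lemma rquot_zero [simp]: "rquot x 0 = 0"
  by (simp add: ncps_eq_iff)

text \<open>A multiplication table that moves left multiplications to the left; with distributivity
  it reduces the relations of t_{4,2} to rewriting. The last identity holds because
  \<open>op24\<close> produces only constants, which commute with \<open>total\<close>.\<close>

lemma ops_mult:
  "rmul f * lmul g = lmul g * rmul f"
  "op24 * lmul (var x) = 0" "op24 * rmul total = 0" "op24 * op24 = 0" "op24 * op34 s = 0"
  "op34 s * op24 = - (lmul (var (B s)) * op24)"
  "op34 s * lmul (var x) = lmul (var x) * op34 s + (if x = B s then lmul (var x) * op24 else 0)"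
  "rmul total * op24 = lmul (var A) * op24 + lmul (var (B 0)) * op24 + lmul (var (B 1)) * op24"
  for s :: bit and x :: ab3
  by (auto intro!: endo_eqI simp: hom_part_zero_mult total_def hom_part_add rquot_var_mult
    hom_part_zero_commute[of _ "var _"] hom_part_zero_commute[of _ "_ * _"] zero_prod_def algebra_simps)

lemma lmul_total: "lmul total = lmul (var A) + lmul (var (B 0)) + lmul (var (B 1))"
  by (simp add: total_def lmul_add)

lemma op_simps:
  "op s 2 3 = lmul (var (B s))" "op s 3 2 = lmul (var (B s))"
  "op s 2 4 = (if s = 0 then op24 else 0)" "op s 4 2 = (if s = 0 then op24 else 0)"
  "op s 3 4 = op34 s" "op s 4 3 = op34 s"
  by (simp_all add: op_def insert_commute doubleton_eq_iff)

lemma op1_simps: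
  "op1 2 = lmul (var A)"
  "op1 3 = rmul total - lmul (var A) - lmul (var (B 0)) - lmul (var (B 1))"
  "op1 4 = - rmul total - op24 - op34 0 - op34 1"
  by (simp_all add: op1_def lmul_total algebra_simps)

lemma commutes_op1: "commutes (op1 i)"
  by (auto simp: op1_def intro!: commutes_ops commutes_diff commutes_uminus)

lemma atLeastAtMost_2_4: "{2..4} = {2, 3, 4 :: nat}"
  by auto

lemma op_pair:
  assumes "{i, j} \<subseteq> {2..4}" "i \<noteq> j"
  shows "commutes (op a i j) \<and> op a i j = op a j i
    \<and> comm (op1 i + op1 j + (\<Sum>c\<in>UNIV. op c i j)) (op a i j) = 0
    \<and> comm (op1 i) (op1 j + (\<Sum>c\<in>UNIV. op c i j)) = 0"
proof -
  have "i = 2 \<and> j = 3 \<or> i = 2 \<and> j = 4 \<or> i = 3 \<and> j = 2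
      \<or> i = 3 \<and> j = 4 \<or> i = 4 \<and> j = 2 \<or> i = 4 \<and> j = 3"
    using assms unfolding atLeastAtMost_2_4 by (simp only: insert_subset insert_iff empty_iff) blast
  then show ?thesis
    unfolding sum_bit
    apply (elim disjE)
         apply (simp_all only: op_simps op1_simps comm_def)
         apply (simp_all add: ops_mult commutes_ops commutes_zero
        distrib_left distrib_right left_diff_distrib right_diff_distrib)
    done
qed

lemma op_triple:
  assumes "{i, j, k} \<subseteq> {2..4}" "distinct [i, j, k]"
  shows "comm (op a i j) (op (a + b) i k + op b j k) = 0 \<and> comm (op1 i) (op a j k) = 0"
proof -
  have "i = 2 \<and> j = 3 \<and> k = 4 \<or> i = 2 \<and> j = 4 \<and> k = 3 \<or> i = 3 \<and> j = 2 \<and> k = 4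
      \<or> i = 3 \<and> j = 4 \<and> k = 2 \<or> i = 4 \<and> j = 2 \<and> k = 3 \<or> i = 4 \<and> j = 3 \<and> k = 2"
    using assms unfolding atLeastAtMost_2_4
    by (simp only: insert_subset insert_iff empty_iff distinct.simps list.set) blast
  then show ?thesis
    apply -
    apply (cases a; cases b; elim disjE)
    apply (simp_all only: op_simps op1_simps comm_def)
    apply (simp_all add: ops_mult distrib_left distrib_right left_diff_distrib right_diff_distrib)
    done
qed

lemma t_rep_op: "t_rep 4 op1 op"
proof -
  \<comment> \<open>With only the strands 2, 3, 4 the relation in four distinct indices is
    vacuous.\<close>
  have "\<not> distinct [i, j, k, l]" if "{i, j, k, l} \<subseteq> {2..4}" for i j k l :: nat
  proof
    assume "distinct [i, j, k, l]"
    from distinct_card[OF this] have "card {i, j, k, l} = 4"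
      by simp
    with card_mono[OF _ that] show False
      by simp
  qed
  note four = this
  show ?thesis
    unfolding t_rep_def
  proof (intro conjI allI impI ballI)
    fix i j k l a b
    assume "{i, j, k, l} \<subseteq> {2..4 :: nat}" "distinct [i, j, k, l]"
    then show "comm (op a i j) (op b k l) = (0 :: 'a pair endo)"
      using four by iprover
  next
    fix i j k a b
    assume "{i, j, k} \<subseteq> {2..4 :: nat}" "distinct [i, j, k]"
    note * = op_triple[OF this]
    show "comm (op a i j) (op (a + b) i k + op b j k) = (0 :: 'a pair endo)"
      by (rule conjunct1[OF *])
    show "comm (op1 i) (op a j k) = (0 :: 'a pair endo)"
      by (rule conjunct2[OF *])
  next
    fix i j a
    assume "{i, j} \<subseteq> {2..4 :: nat}" "i \<noteq> j"
    note * = op_pair[OF this]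
    show "commutes (op a i j :: 'a pair endo)"
      by (rule conjunct1[OF *])
    show "op a i j = (op a j i :: 'a pair endo)"
      by (rule conjunct1[OF conjunct2[OF *]])
    show "comm (op1 i + op1 j + (\<Sum>c\<in>UNIV. op c i j)) (op a i j) = (0 :: 'a pair endo)"
      by (rule conjunct1[OF conjunct2[OF conjunct2[OF *]]])
    show "comm (op1 i) (op1 j + (\<Sum>c\<in>UNIV. op c i j)) = (0 :: 'a pair endo)"
      by (rule conjunct2[OF conjunct2[OF conjunct2[OF *]]])
  qed (rule commutes_op1)
qed

section \<open>The octagon defect in the representation\<close>

lemma UNIV_ab3: "UNIV = {A, B 0, B 1}"
proof -
  have "x \<in> {A, B 0, B 1}" for x
  proof (cases x)
    case (B b)
    then show ?thesis
      by (cases b) simp_all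
  qed simp
  then show ?thesis
    by blast
qed

lemma UNIV_ab: "UNIV = {LA, LB}"
  using ab.exhaust by auto

lemma sum_words_two: "(\<Sum>w\<in>words UNIV 2. h w) = (\<Sum>x\<in>UNIV. \<Sum>z\<in>UNIV. h [x, z])"
proof -
  have "(\<Sum>w\<in>words UNIV 2. h w) = (\<Sum>(x, z)\<in>UNIV \<times> UNIV. h [x, z])"
    by (rule sum.reindex_bij_witness[where i = "\<lambda>(x, z). [x, z]" and j = "\<lambda>w. (hd w, hd (tl w))"])
      (auto simp: words_def length_Suc_conv numeral_2_eq_2)
  then show ?thesis
    by (simp add: sum.cartesian_product)
qed

text \<open>Without constant terms, the degree-two part of a bracket is the commutator of the linear
  parts, hence antisymmetric in the two letters.\<close>

lemma lie_poly_coeffs: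
  assumes "f \<in> lie_poly S"
  shows "coeff f [] = 0 \<and> coeff f [x, x] = 0 \<and> coeff f [z, x] = - coeff f [x, z]"
  using assms
  by induction (auto simp: coeff_var bracket_def coeff_mult numeral_2_eq_2)

lemma free_lie_coeffs:
  assumes "f \<in> free_lie S"
  shows "coeff f [] = 0" "coeff f [x, x] = 0" "coeff f [z, x] = - coeff f [x, z]"
proof -
  have "hom_part d f \<in> lie_poly S" for d
    using assms by (simp add: free_lie_def completion_def)
  from lie_poly_coeffs[OF this[of 0]] lie_poly_coeffs[OF this[of 2], of x z]
  show "coeff f [] = 0" "coeff f [x, x] = 0" "coeff f [z, x] = - coeff f [x, z]"
    by (simp_all add: coeff_hom_part)
qed

context scalars
begin

lemma eval3_two:
  assumes "\<psi> \<in> free_lie UNIV"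
  shows "eval3 2 \<psi> X Y0 Y1 = \<kappa> (coeff \<psi> [A, B 0]) * comm X Y0
    + \<kappa> (coeff \<psi> [A, B 1]) * comm X Y1 + \<kappa> (coeff \<psi> [B 0, B 1]) * comm Y0 Y1"
proof -
  have minus: "\<kappa> (- c) = - \<kappa> c" for c
    using \<kappa>_diff[of 0 c] by (simp add: \<kappa>_zero)
  note c = free_lie_coeffs(2)[OF assms] free_lie_coeffs(3)[OF assms, of "B _" A] free_lie_coeffs(3)[OF assms, of "B 1" "B 0"]
  show ?thesis
    unfolding eval3_def eval_def sum_words_two by (simp add: UNIV_ab3 c minus \<kappa>_zero comm_def algebra_simps)
qed

lemma eval2_two:
  assumes "\<phi> \<in> free_lie UNIV"
  shows "eval2 2 \<phi> X Y = \<kappa> (coeff \<phi> [LA, LB]) * comm X Y"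
proof -
  have minus: "\<kappa> (- c) = - \<kappa> c" for c
    using \<kappa>_diff[of 0 c] by (simp add: \<kappa>_zero)
  note c = free_lie_coeffs(2)[OF assms] free_lie_coeffs(3)[OF assms, of LB LA]
  show ?thesis
    unfolding eval2_def eval_def sum_words_two by (simp add: UNIV_ab c minus \<kappa>_zero comm_def algebra_simps)
qed

end

section \<open>Degree two of psi\<close>

lemma scale_zero_left: "scale 0 f = 0"
  by (simp add: ncps_eq_iff)

lemma scale_diff_left: "scale (a - b) f = scale a f - scale b f"
  by (simp add: ncps_eq_iff algebra_simps)

lemma scale_add_left: "scale (a + b) f = scale a f + scale b f"
  by (simp add: ncps_eq_iff algebra_simps)

lemma scale_one: "scale 1 f = f"
  by (simp add: ncps_eq_iff)

lemma scale_scale: "scale a (scale b f) = scale (a * b) f"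
  by (simp add: ncps_eq_iff mult.assoc)

lemma hom_part_zero_one [simp]: "hom_part 0 1 = 1"
  by (simp add: ncps_eq_iff coeff_hom_part coeff_one)

lemma rquot_one [simp]: "rquot x 1 = 0"
  by (simp add: ncps_eq_iff coeff_one)

lemma rquot_var: "rquot x (var z) = (if x = z then 1 else 0)"
  using rquot_mult_var[of x 1 z] by simp

text \<open>In degree 2, psi is b [A, B(1)] + c [B(0), B(1)]. In the second entry of the image of
  (1, 0), the plain pentagon equation has the coefficient -2c at B(1); with strand 4 flipped, the
  coefficient at B(0) is c - b. At both places phi contributes nothing.\<close>

lemma degree_two_eq_zero:
  fixes \<phi> :: "(ab, 'k::field_char_0) ncps"
  assumes \<phi>: "\<phi> \<in> free_lie UNIV" and \<psi>: "\<psi> \<in> free_lie UNIV"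
    and c: "coeff \<psi> [A, B 0] = 0"
    and pentagon: "mixed_pentagon \<phi> \<psi>"
  shows "hom_part 2 \<psi> = 0"
proof -
  define b where "b = coeff \<psi> [A, B 1]"
  define c where "c = coeff \<psi> [B 0, B 1]"
  define f where "f = coeff \<phi> [LA, LB]"
  let ?E = "\<lambda>\<epsilon>. pentagon_defect 2 \<phi> \<psi> op1 (\<lambda>a i j. op (a + \<epsilon> i + \<epsilon> j) i j) 2 3 4"
  have E: "?E \<epsilon> = 0" for \<epsilon>
    by (rule pentagon_defect_signed_perm_eq_zero[OF t_rep_op pentagon]) auto
  have E1: "coeff (snd (app (?E (\<lambda>_. 0)) (1, 0))) [B 1] = 0"
    unfolding E by simp
  have E2: "coeff (snd (app (?E ((\<lambda>_. 0)(4 := 1))) (1, 0))) [B 0] = 0"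
    unfolding E by simp
  have "2 * c = 0"
    using E1 assms(3)
    by (simp add: pentagon_defect_def op_simps op1_simps eval3_two[OF \<psi>] eval2_two[OF \<phi>] comm_def b_def c_def f_def
    total_def rquot_add rquot_diff rquot_var coeff_var coeff_hom_part)
  have "c = b"
    using E2 assms(3)
    by (simp add: pentagon_defect_def op_simps op1_simps eval3_two[OF \<psi>] eval2_two[OF \<phi>] comm_def b_def c_def f_def
    total_def rquot_add rquot_diff rquot_var coeff_var coeff_hom_part)
  have zero: "coeff \<psi> [A, B 0] = 0" "coeff \<psi> [A, B 1] = 0" "coeff \<psi> [B 0, B 1] = 0"
    using \<open>2 * c = 0\<close> \<open>c = b\<close> assms(3) by (simp_all add: b_def c_def)
  have "coeff \<psi> [x, z] = 0" for x z
  proof -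
    have "x \<in> {A, B 0, B 1}" "z \<in> {A, B 0, B 1}"
      using UNIV_ab3 by blast+
    then show ?thesis
      using zero free_lie_coeffs(2)[OF \<psi>] free_lie_coeffs(3)[OF \<psi>, of "B _" A]
        free_lie_coeffs(3)[OF \<psi>, of "B 1" "B 0"] by auto
  qed
  then show ?thesis
    by (auto simp: ncps_eq_iff coeff_hom_part numeral_2_eq_2 length_Suc_conv)
qed


text \<open>Acting on $(1, 0)$, the doubled strand records the last letter.\<close>

lemma eval_doubled:
  "app (eval UNIV (case_ab3 (lmul (var A)) (case_bit (lmul (var (B 0)) + op24) (lmul (var (B 1))))) d f) (1, 0)
    = (hom_part d f, rquot (B 0) (hom_part d f))"
proof -
  let ?\<rho> = "case_ab3 (lmul (var A)) (case_bit (lmul (var (B 0)) + op24) (lmul (var (B 1))))"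
  let ?m = "\<lambda>w. prod_list (map var w) :: (ab3, 'a) ncps"
  have coeff: "coeff (?m w) v = (if v = w then 1 else 0)" for w v
    by (induction w arbitrary: v) (auto simp: coeff_one coeff_var_mult split: list.split)
  \<comment> \<open>A word acts from its last letter on. \<open>op24\<close> meets a constant term
    only in this first action, so \<open>m\<close> becomes the rest of the word if the last letter
    is B(0), and stays 0 otherwise.\<close>
  have word: "app (prod_list (map ?\<rho> w)) (1, 0) = (?m w, rquot (B 0) (?m w))" for w
  proof (induction w)
    case (Cons x w)
    have "x \<in> {A, B 0, B 1}"
      using UNIV_ab3 by blast
    with Cons show ?case
      by (auto simp: rquot_var_mult)
  qed simp
  have "app (\<Sum>w\<in>W. scalar (coeff f w) * prod_list (map ?\<rho> w)) (1, 0)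
      = ((\<Sum>w\<in>W. scale (coeff f w) (?m w)), rquot (B 0) (\<Sum>w\<in>W. scale (coeff f w) (?m w)))" for W
    by (induction W rule: infinite_finite_induct) (simp_all add: word rquot_add rquot_scale zero_prod_def)
  moreover have "(\<Sum>w\<in>words UNIV d. scale (coeff f w) (?m w)) = hom_part d f"
  proof -
    have "coeff (\<Sum>w\<in>W. scale (coeff f w) (?m w)) v = (if v \<in> W then coeff f v else 0)" if "finite W" for W v
      using that by (induction W rule: finite_induct) (auto simp: coeff)
    then show ?thesis
      by (simp add: ncps_eq_iff coeff_hom_part finite_words) (simp add: words_UNIV)
  qed
  ultimately have "app (\<Sum>w\<in>words UNIV d. scalar (coeff f w) * prod_list (map ?\<rho> w)) (1, 0)
      = (hom_part d f, rquot (B 0) (hom_part d f))"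
    by simp
  then show ?thesis
    unfolding eval_def .
qed

text \<open>With \<open>z = total\<close> these spaces hold the octagon at t^{24}, with
  \<open>z = var (B 0)\<close> the values of phi. As the letter recorded in \<open>m\<close> counts
  for the degree, degree 0 leaves no room for \<open>m\<close>; hence the case distinction.\<close>

definition power_pairs :: "(ab3, 'k::field) ncps \<Rightarrow> nat \<Rightarrow> 'k pair set"
  where "power_pairs z d = {(scale a (z ^ d), if d = 0 then 0 else scale b (z ^ (d - 1))) | a b. True}"

text \<open>Each letter raises the degree by one, so a word of length \<open>d\<close> maps
  \<open>N 0\<close> into \<open>N d\<close>; the value is a combination of such words.\<close>

lemma eval_invariant:
  fixes \<rho> :: "'x::finite \<Rightarrow> 'k::field pair endo"
  assumes \<rho>: "\<And>x d v. v \<in> N d \<Longrightarrow> app (\<rho> x) v \<in> N (Suc d)"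
    and zero: "\<And>d. 0 \<in> N d" and add: "\<And>d v w. v \<in> N d \<Longrightarrow> w \<in> N d \<Longrightarrow> v + w \<in> N d"
    and scale: "\<And>d c v. v \<in> N d \<Longrightarrow> app (scalar c) v \<in> N d" and "v \<in> N 0"
  shows "app (eval UNIV \<rho> d f) v \<in> N d"
proof -
  have "app (prod_list (map \<rho> w)) v \<in> N (length w)" for w
    by (induction w) (simp_all add: assms)
  then have "app (prod_list (map \<rho> w)) v \<in> N d" if "w \<in> words UNIV d" for w
    using that by (auto simp: words_UNIV)
  then have word: "app (scalar c * prod_list (map \<rho> w)) v \<in> N d" if "w \<in> words UNIV d" for c w
    unfolding app_times using that by (intro scale)
  have "sum h I \<in> N d" if "\<And>i. i \<in> I \<Longrightarrow> h i \<in> N d" for h and I :: "'x list set"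
    using that by (induction I rule: infinite_finite_induct) (auto simp: zero add)
  note sum = this
  show ?thesis
    unfolding eval_def app_sum by (rule sum) (rule word)
qed

lemma power_pairsI: "(scale a (z ^ d), if d = 0 then 0 else scale b (z ^ (d - 1))) \<in> power_pairs z d"
  unfolding power_pairs_def by blast

lemma power_pairsE:
  assumes "v \<in> power_pairs z d"
  obtains a b where "v = (scale a (z ^ d), if d = 0 then 0 else scale b (z ^ (d - 1)))"
  using assms unfolding power_pairs_def by blast

lemma power_pairs_zero: "0 \<in> power_pairs z d"
  using power_pairsI[of 0 z d 0] by (cases d) (simp_all add: scale_zero_left zero_prod_def)

lemma power_pairs_one: "(1, 0) \<in> power_pairs z 0"
  using power_pairsI[of 1 z 0 0] by (simp add: scale_one)

lemma power_pairs_add: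
  assumes "v \<in> power_pairs z d" "w \<in> power_pairs z d"
  shows "v + w \<in> power_pairs z d"
proof -
  obtain a b where v: "v = (scale a (z ^ d), if d = 0 then 0 else scale b (z ^ (d - 1)))"
    using assms(1) by (rule power_pairsE)
  obtain a' b' where w: "w = (scale a' (z ^ d), if d = 0 then 0 else scale b' (z ^ (d - 1)))"
    using assms(2) by (rule power_pairsE)
  have "v + w = (scale (a + a') (z ^ d), if d = 0 then 0 else scale (b + b') (z ^ (d - 1)))"
    by (simp add: v w scale_add_left)
  then show ?thesis
    by (simp only: power_pairsI)
qed

lemma power_pairs_scalar:
  assumes "v \<in> power_pairs z d"
  shows "app (scalar c) v \<in> power_pairs z d"
proof -
  obtain a b where v: "v = (scale a (z ^ d), if d = 0 then 0 else scale b (z ^ (d - 1)))"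
    using assms by (rule power_pairsE)
  have "app (scalar c) v = (scale (c * a) (z ^ d), if d = 0 then 0 else scale (c * b) (z ^ (d - 1)))"
    by (simp add: v scale_scale)
  then show ?thesis
    by (simp only: power_pairsI)
qed

lemmas eval_power_pairs = eval_invariant[where N = "power_pairs z" for z,
  OF _ power_pairs_zero power_pairs_add power_pairs_scalar power_pairs_one]

lemma power_pairs_ops:
  fixes v :: "'k::field pair"
  assumes v: "v \<in> power_pairs z d"
  shows "app (lmul z) v \<in> power_pairs z (Suc d)" "app (rmul z) v \<in> power_pairs z (Suc d)"
    "hom_part 0 z = 0 \<Longrightarrow> app op24 v \<in> power_pairs z (Suc d)"
    "z = var (B s) \<Longrightarrow> app (op34 s) v \<in> power_pairs z (Suc d)"
proof -
  obtain a b where v: "v = (scale a (z ^ d), if d = 0 then 0 else scale b (z ^ (d - 1)))"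
    using v by (rule power_pairsE)
  have intro: "(scale a (z ^ Suc d), scale b (z ^ d)) \<in> power_pairs z (Suc d)" for a b
    using power_pairsI[of a z "Suc d" b] by simp
  have commute: "z ^ d * z = z * z ^ d" for d
    by (rule power_commutes)
  have "app (lmul z) v = (scale a (z ^ Suc d), scale (if d = 0 then 0 else b) (z ^ d))"
    by (cases d) (simp_all add: v scale_mult_right scale_zero_left)
  then show "app (lmul z) v \<in> power_pairs z (Suc d)"
    by (simp only: intro)
  have "app (rmul z) v = (scale a (z ^ Suc d), scale (if d = 0 then 0 else b) (z ^ d))"
    by (cases d) (simp_all add: v scale_mult_left scale_zero_left commute mult.assoc)
  then show "app (rmul z) v \<in> power_pairs z (Suc d)"
    by (simp only: intro)
  show "app op24 v \<in> power_pairs z (Suc d)" if "hom_part 0 z = 0"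
  proof -
    \<comment> \<open>Positive powers of \<open>z\<close> have no constant term, so
      \<open>op24\<close> acts only in degree 0, where it moves the scalar \<open>a\<close> into the
      second entry.\<close>
    have "app op24 v = (scale 0 (z ^ Suc d), scale (if d = 0 then a else 0) (z ^ d))"
      by (cases d) (simp_all add: v hom_part_scale hom_part_zero_mult scale_zero_left that)
    then show ?thesis
      by (simp only: intro)
  qed
  show "app (op34 s) v \<in> power_pairs z (Suc d)" if "z = var (B s)"
  proof -
    have "rquot (B s) (z ^ Suc e) = z ^ e" for e
      unfolding power_Suc2 by (simp add: that rquot_mult_var)
    \<comment> \<open>For \<open>d > 0\<close> the quotient removes the last factor of a z^d, the
      difference with b z^(d-1) is (a - b) z^(d-1), and the final factor \<open>z\<close> restores
      the power.\<close>
    then have "app (op34 s) v = (scale 0 (z ^ Suc d), scale (if d = 0 then 0 else a - b) (z ^ d))"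
      by (cases d) (simp_all add: v that[symmetric] rquot_scale scale_zero_left left_diff_distrib
        scale_mult_left commute scale_diff_left del: power_Suc, simp_all)
    then show ?thesis
      by (simp only: intro)
  qed
qed

section \<open>The octagon defect as a series, and its right quotient by B(0)\<close>

definition octagon_series :: "(ab3, 'k::field) ncps \<Rightarrow> (ab3, 'k) ncps"
  where "octagon_series \<psi> =
    subst3 \<psi> (var A) (var (B 0)) (var (B 1)) - subst3 \<psi> (var A) (var (B 1)) (var (B 0))
    + subst3 \<psi> (- total) (var (B 1)) (var (B 0)) - subst3 \<psi> (- total) (var (B 0)) (var (B 1))"

lemma hom_part_uminus: "hom_part d (- f) = - hom_part d f"
  by (simp add: ncps_eq_iff coeff_hom_part)

lemma hom_part_total: "hom_part 1 total = total"
  by (simp add: total_def hom_part_add hom_part_var[simplified])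

context scalars
begin

lemma eval_uminus: "eval S \<rho> d (- f) = - eval S \<rho> d f"
  using eval_diff[of S \<rho> d 0 f] by (simp add: eval_zero)

lemma eval_octagon_series:
  assumes "commutes X" "commutes Y0" "commutes Y1"
  shows "eval3 d (octagon_series \<psi>) X Y0 Y1 = octagon d \<psi> X Y0 Y1 (- X - Y0 - Y1)"
proof -
  let ?\<rho> = "case_ab3 X (case_bit Y0 Y1)"
  have com: "commutes (?\<rho> x)" for x
    using assms by (auto split: ab3.split bit.split)
  have var: "eval UNIV ?\<rho> (Suc 0) (var x) = ?\<rho> x" for x
    using eval_var[of UNIV x ?\<rho>] by simp
  have hom: "hom_part (Suc 0) (- total) = - (total :: (ab3, 'k) ncps)"
    using hom_part_total by (simp add: hom_part_uminus)
  have total: "eval UNIV ?\<rho> (Suc 0) (- total) = - X - Y0 - Y1"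
    by (simp add: eval_uminus eval_diff total_def eval_add var)
  show ?thesis
    unfolding octagon_series_def octagon_def eval3_def[of d "_ - _"] eval_diff eval_add
    by (simp add: eval_subst3[OF _ com, simplified] hom hom_part_var[simplified] var total)
qed

end

text \<open>Since the generators add up to 0, the fourth argument here is exactly minus the sum of
  the other three, as for C. So this octagon is a value of \<open>octagon_series\<close>, and
  \<open>eval_doubled\<close> reads off the last letters.\<close>

lemma octagon_doubled:
  "snd (app (octagon (Suc n) \<psi> (op1 2) (op 0 2 3 + op 0 2 4) (op 1 2 3 + op 1 2 4)
      (op1 3 + op1 4 + op 0 3 4 + op 1 3 4)) (1, 0))
    = rquot (B 0) (hom_part (Suc n) (octagon_series \<psi>))"
proof -
  have "octagon (Suc n) \<psi> (op1 2) (op 0 2 3 + op 0 2 4) (op 1 2 3 + op 1 2 4) (op1 3 + op1 4 + op 0 3 4 + op 1 3 4)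
      = eval3 (Suc n) (octagon_series \<psi>) (lmul (var A)) (lmul (var (B 0)) + op24) (lmul (var (B 1)))"
  proof (subst eval_octagon_series)
    have eq: "op1 3 + op1 4 + op 0 3 4 + op 1 3 4 = - lmul (var A) - (lmul (var (B 0)) + op24) - lmul (var (B 1))"
      by (simp add: op_simps op1_simps)
    show "octagon (Suc n) \<psi> (op1 2) (op 0 2 3 + op 0 2 4) (op 1 2 3 + op 1 2 4) (op1 3 + op1 4 + op 0 3 4 + op 1 3 4)
      = octagon (Suc n) \<psi> (lmul (var A)) (lmul (var (B 0)) + op24) (lmul (var (B 1)))
          (- lmul (var A) - (lmul (var (B 0)) + op24) - lmul (var (B 1)))"
      unfolding eq by (simp add: op_simps op1_simps)
  qed (intro commutes_ops commutes_add)+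
  then show ?thesis
    by (simp only: eval3_def eval_doubled snd_conv)
qed

lemma power_pairs_snd:
  "v \<in> power_pairs z (Suc n) \<Longrightarrow> \<exists>b. snd v = scale b (z ^ n)"
  by (auto simp: power_pairs_def)

lemma power_pairs_diff:
  assumes "v \<in> power_pairs z d" "w \<in> power_pairs z d"
  shows "v - w \<in> power_pairs z d"
proof -
  have "app (scalar (- 1)) w = - w"
    by (cases w) (simp add: ncps_eq_iff)
  then have "- w \<in> power_pairs z d"
    using power_pairs_scalar[OF assms(2)] by metis
  from power_pairs_add[OF assms(1) this] show ?thesis
    by simp
qed

text \<open>The arguments are built from \<open>lmul total\<close>, \<open>rmul total\<close> and
  \<open>op24\<close>; starting from (1, 0), these never leave the powers of
  \<open>total\<close>.\<close>

lemma octagon_24: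
  fixes \<psi> :: "(ab3, 'k::field) ncps"
  shows
  "\<exists>c. snd (app (octagon (Suc n) \<psi> (op1 2 + op 0 2 3 + op 1 2 3) (op 0 2 4) (op 1 2 4)
      (op1 4 + op 0 3 4 + op 1 3 4)) (1, 0)) = scale c (total ^ n)"
proof (rule power_pairs_snd)
  have total: "hom_part 0 total = 0"
    by (simp add: total_def hom_part_add)
  have eq: "op1 2 + op 0 2 3 + op 1 2 3 = lmul total" "op1 4 + op 0 3 4 + op 1 3 4 = - rmul total - op24"
    "op 0 2 4 = op24" "op 1 2 4 = 0"
    by (simp_all add: op_simps op1_simps lmul_total)
  have ops: "app T v \<in> power_pairs total (Suc d)"
    if "T \<in> {lmul total, op24, 0, - rmul total - op24}" "v \<in> power_pairs total d" for T v d
    using power_pairs_ops[OF that(2)] total power_pairs_zero[of total "Suc d"] that(1)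
      power_pairs_diff[OF power_pairs_diff[OF power_pairs_zero[of total "Suc d"] power_pairs_ops(2)[OF that(2)]]
        power_pairs_ops(3)[OF that(2) total]]
    by (auto simp del: app_ops)
  have "app (eval3 (Suc n) \<psi> X Y0 Y1) (1, 0) \<in> power_pairs total (Suc n)"
    if "{X, Y0, Y1} \<subseteq> {lmul total, op24, 0, - rmul total - op24}" for X Y0 Y1 :: "'k pair endo"
    unfolding eval3_def
  proof (rule eval_power_pairs)
    fix x d and v :: "'k pair" assume "v \<in> power_pairs total d"
    moreover have "case_ab3 X (case_bit Y0 Y1) x \<in> {lmul total, op24, 0, - rmul total - op24}"
      using that by (auto split: ab3.split bit.split)
    ultimately show "app (case_ab3 X (case_bit Y0 Y1) x) v \<in> power_pairs total (Suc d)"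
      by (rule ops[rotated])
  qed
  then show "app (octagon (Suc n) \<psi> (op1 2 + op 0 2 3 + op 1 2 3) (op 0 2 4) (op 1 2 4)
      (op1 4 + op 0 3 4 + op 1 3 4)) (1, 0) \<in> power_pairs total (Suc n)"
    unfolding octagon_def eq app_plus app_fun_diff
    by (intro power_pairs_add power_pairs_diff) auto
qed

lemma snd_eval_eq_zero:
  fixes \<rho> :: "'x::finite \<Rightarrow> 'k::field pair endo"
  assumes "\<And>x u. u \<in> U \<Longrightarrow> \<exists>u' \<in> U. app (\<rho> x) (u, 0) = (u', 0)"
    and "1 \<in> U" "0 \<in> U" "\<And>u u'. u \<in> U \<Longrightarrow> u' \<in> U \<Longrightarrow> u + u' \<in> U" "\<And>c u. u \<in> U \<Longrightarrow> scale c u \<in> U"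
  shows "snd (app (eval UNIV \<rho> d f) (1, 0)) = 0"
proof -
  have "app (eval UNIV \<rho> d f) (1, 0) \<in> U \<times> {0}"
  proof (rule eval_invariant[where N = "\<lambda>_. U \<times> {0}"])
    show "app (\<rho> x) v \<in> U \<times> {0}" if "v \<in> U \<times> {0}" for x v
      using assms(1)[of "fst v" x] that by auto
  qed (use assms in \<open>auto simp: zero_prod_def\<close>)
  then show ?thesis
    by auto
qed

text \<open>Strand 4 is absent here, and left and right multiplications act on the two entries
  separately, so nothing reaches the second one.\<close>

lemma octagon_23:
  "snd (app (octagon d \<psi> (op1 2) (op 0 2 3) (op 1 2 3) (op1 3)) (1, 0)) = 0"
proof -
  have "snd (app (eval3 d \<psi> X Y0 Y1) (1, 0)) = 0"
    if "{X, Y0, Y1} \<subseteq> {op1 2, op 0 2 3, op 1 2 3, op1 3}" for X Y0 Y1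
    unfolding eval3_def
  proof (rule snd_eval_eq_zero[where U = UNIV])
    fix x u
    have "case_ab3 X (case_bit Y0 Y1) x \<in> {op1 2, op 0 2 3, op 1 2 3, op1 3}"
      using that by (auto split: ab3.split bit.split)
    then show "\<exists>u'\<in>UNIV. app (case_ab3 X (case_bit Y0 Y1) x) (u, 0) = (u', 0)"
      by (auto simp: op_simps op1_simps)
  qed auto
  then show ?thesis
    unfolding octagon_def by simp
qed

text \<open>In these four terms B(0) is the only letter that occurs: the arguments are its left
  multiplication, \<open>op24\<close>, \<open>op34 0\<close> and 0.\<close>

lemma eval2_powers:
  fixes \<phi> :: "(ab, 'k::field) ncps"
  shows
  "\<exists>c. snd (app (eval2 (Suc n) \<phi> (op 0 2 3) (op 0 3 4) + eval2 (Suc n) \<phi> (op 0 3 4) (op 0 2 4)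
      - eval2 (Suc n) \<phi> (op 0 3 4) (op 1 2 4) - eval2 (Suc n) \<phi> (op 0 2 3) (op 0 2 4)) (1, 0)) = scale c (var (B 0) ^ n)"
proof (rule power_pairs_snd)
  let ?z = "var (B 0)"
  have ops: "app T v \<in> power_pairs ?z (Suc d)"
    if "T \<in> {lmul ?z, op24, 0, op34 0}" "v \<in> power_pairs ?z d" for T v d
    using power_pairs_ops[OF that(2)] power_pairs_zero[of ?z "Suc d"] that(1)
    by (auto simp del: app_ops)
  have "app (eval2 (Suc n) \<phi> X Y) (1, 0) \<in> power_pairs ?z (Suc n)"
    if "{X, Y} \<subseteq> {lmul ?z, op24, 0, op34 0}" for X Y :: "'k pair endo"
    unfolding eval2_def
  proof (rule eval_power_pairs)
    fix x d and v :: "'k pair" assume "v \<in> power_pairs ?z d"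
    moreover have "case_ab X Y x \<in> {lmul ?z, op24, 0, op34 0}"
      using that by (auto split: ab.split)
    ultimately show "app (case_ab X Y x) v \<in> power_pairs ?z (Suc d)"
      by (rule ops[rotated])
  qed
  then show "app (eval2 (Suc n) \<phi> (op 0 2 3) (op 0 3 4) + eval2 (Suc n) \<phi> (op 0 3 4) (op 0 2 4)
      - eval2 (Suc n) \<phi> (op 0 3 4) (op 1 2 4) - eval2 (Suc n) \<phi> (op 0 2 3) (op 0 2 4)) (1, 0) \<in> power_pairs ?z (Suc n)"
    unfolding op_simps app_plus app_fun_diff
    by (intro power_pairs_add power_pairs_diff) auto
qed

text \<open>Left multiplications by B(1), starting from 1, never create a word ending in B(0), and
  on pairs \<open>(u, 0)\<close> such words are all that \<open>op34 0\<close> detects.\<close>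

lemma eval2_vanish:
  assumes "Y \<in> {op34 0, 0}"
  shows "snd (app (eval2 d \<phi> (op 1 2 3) Y) (1, 0)) = 0"
  unfolding eval2_def
proof (rule snd_eval_eq_zero[where U = "{u. rquot (B 0) u = 0}"])
  fix x and u :: "(ab3, 'a) ncps" assume "u \<in> {u. rquot (B 0) u = 0}"
  then show "\<exists>u' \<in> {u. rquot (B 0) u = 0}. app (case_ab (op 1 2 3) Y x) (u, 0) = (u', 0)"
    using assms by (cases x) (auto simp: op_simps rquot_var_mult zero_prod_def)
qed (auto simp: rquot_add rquot_scale)

lemma rquot_octagon_series:
  fixes \<phi> :: "(ab, 'k::field) ncps"
  assumes pentagon: "mixed_pentagon \<phi> \<psi>"
  shows "\<exists>c c'. rquot (B 0) (hom_part (Suc n) (octagon_series \<psi>)) = scale c (total ^ n) + scale c' (var (B 0) ^ n)"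
proof -
  obtain c where c: "snd (app (octagon (Suc n) \<psi> (op1 2 + op 0 2 3 + op 1 2 3) (op 0 2 4) (op 1 2 4)
      (op1 4 + op 0 3 4 + op 1 3 4)) (1, 0)) = scale c (total ^ n)"
    using octagon_24 by blast
  obtain c' where c': "snd (app (eval2 (Suc n) \<phi> (op 0 2 3) (op 0 3 4) + eval2 (Suc n) \<phi> (op 0 3 4) (op 0 2 4)
      - eval2 (Suc n) \<phi> (op 0 3 4) (op 1 2 4) - eval2 (Suc n) \<phi> (op 0 2 3) (op 0 2 4)) (1, 0)) = scale c' (var (B 0) ^ n)"
    using eval2_powers by blast
  have "rquot (B 0) (hom_part (Suc n) (octagon_series \<psi>)) = scale c (total ^ n) + scale c' (var (B 0) ^ n)"
    \<comment> \<open>The identity \<open>octagon_doubling\<close> is applied to (1, 0) and compared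
      in the second entry; the octagon on the strands 2, 3 and the two values of phi at t^{23}_-
      contribute 0.\<close>
    unfolding c[symmetric] c'[symmetric] octagon_doubled[symmetric] octagon_doubling[OF t_rep_op pentagon]
    using octagon_23[of "Suc n" \<psi>] eval2_vanish[of "op 0 3 4" "Suc n" \<phi>] eval2_vanish[of "op 1 2 4" "Suc n" \<phi>]
    by (simp del: app_ops add: op_simps(3-6))
  then show ?thesis
    by blast
qed

section \<open>The symmetries of the octagon defect\<close>

text \<open>A chain rule: as each \<open>\<sigma> x\<close> is linear, the last letter of the image
  of a word comes from the image of its last letter.\<close>

lemma rquot_subst:
  fixes \<sigma> :: "'x::finite \<Rightarrow> ('z, 'k::field) ncps"
  assumes hom: "\<And>x. hom_part 1 (\<sigma> x) = \<sigma> x"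
  shows "rquot z (subst \<sigma> f) = (\<Sum>x\<in>UNIV. scale (coeff (\<sigma> x) [z]) (subst \<sigma> (rquot x f)))"
  unfolding ncps_eq_iff
proof
  fix v
  let ?P = "\<lambda>w. coeff (prod_list (map \<sigma> w))"
  have coeff_sum: "coeff (sum h I) w = (\<Sum>i\<in>I. coeff (h i) w)" for h :: "'x \<Rightarrow> ('z, 'k) ncps" and I w
    by (induction I rule: infinite_finite_induct) auto
  have "coeff (rquot z (subst \<sigma> f)) v = (\<Sum>w | length w = Suc (length v). coeff f w * ?P w (v @ [z]))"
    by (simp add: coeff_subst_hom[OF hom])
  also have "\<dots> = (\<Sum>(x, u)\<in>UNIV \<times> {u. length u = length v}. coeff f (u @ [x]) * ?P (u @ [x]) (v @ [z]))"
    by (rule sum.reindex_bij_witness[where i = "\<lambda>(x, u). u @ [x]" and j = "\<lambda>w. (last w, butlast w)"])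
      (auto simp: length_Suc_conv_rev)
  also have "\<dots> = (\<Sum>x\<in>UNIV. \<Sum>u | length u = length v. coeff f (u @ [x]) * ?P (u @ [x]) (v @ [z]))"
    by (simp add: sum.cartesian_product)
  also have "\<dots> = (\<Sum>x\<in>UNIV. \<Sum>u | length u = length v. coeff (\<sigma> x) [z] * (coeff f (u @ [x]) * ?P u v))"
  proof (intro sum.cong refl)
    fix x and u :: "'x list" assume u: "u \<in> {u. length u = length v}"
    then have "?P (u @ [x]) (v @ [z]) = ?P u v * coeff (\<sigma> x) [z]"
      using coeff_prod_word[OF hom, of u "[x]" "v @ [z]"] by simp
    then show "coeff f (u @ [x]) * ?P (u @ [x]) (v @ [z]) = coeff (\<sigma> x) [z] * (coeff f (u @ [x]) * ?P u v)"
      by (simp only: ac_simps)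
  qed
  finally show "coeff (rquot z (subst \<sigma> f)) v
      = coeff (\<Sum>x\<in>UNIV. scale (coeff (\<sigma> x) [z]) (subst \<sigma> (rquot x f))) v"
    by (simp add: coeff_sum coeff_subst_hom[OF hom] sum_distrib_left)
qed

lemma subst_one:
  fixes \<sigma> :: "'x::finite \<Rightarrow> ('z, 'k::field) ncps"
  assumes hom: "\<And>x. hom_part 1 (\<sigma> x) = \<sigma> x"
  shows "subst \<sigma> 1 = 1"
  unfolding ncps_eq_iff
proof
  fix v
  have "coeff (subst \<sigma> 1) v = (\<Sum>w :: 'x list | length w = length v. if w = [] then coeff 1 v else 0)"
    unfolding coeff_subst_hom[OF hom] by (intro sum.cong refl) (auto simp: coeff_one)
  also have "\<dots> = coeff 1 v"
    using finite_words[of "UNIV :: 'x set" "length v"] by (auto simp: words_UNIV coeff_one)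
  finally show "coeff (subst \<sigma> 1) v = coeff 1 v" .
qed

lemma subst_power:
  fixes \<sigma> :: "'x::finite \<Rightarrow> ('z, 'k::field) ncps"
  assumes hom: "\<And>x. hom_part 1 (\<sigma> x) = \<sigma> x"
  shows "subst \<sigma> (f ^ n) = subst \<sigma> f ^ n"
  by (induction n) (simp_all add: subst_one[OF hom] subst_mult[OF hom])

lemma subst_zero: "subst \<sigma> 0 = 0"
  by (simp add: ncps_eq_iff coeff_subst)

lemma subst_uminus: "subst \<sigma> (- f) = - subst \<sigma> f"
  by (simp add: ncps_eq_iff coeff_subst sum_negf)

lemma subst_subst:
  fixes \<sigma> :: "'x::finite \<Rightarrow> ('total::finite, 'k::field) ncps" and \<tau> :: "'total \<Rightarrow> ('z, 'k) ncps"
  assumes \<sigma>: "\<And>x. hom_part 1 (\<sigma> x) = \<sigma> x" and \<tau>: "\<And>x. hom_part 1 (\<tau> x) = \<tau> x"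
  shows "subst \<tau> (subst \<sigma> f) = subst (\<lambda>x. subst \<tau> (\<sigma> x)) f"
  unfolding ncps_eq_iff
proof
  fix v
  let ?L = "\<lambda>n. {w. length w = n}"
  have hom: "hom_part 1 (subst \<tau> (\<sigma> x)) = subst \<tau> (\<sigma> x)" for x
    by (simp add: subst_hom_part[OF \<tau>] \<sigma>[simplified])
  have word: "subst \<tau> (prod_list (map \<sigma> u)) = prod_list (map (\<lambda>x. subst \<tau> (\<sigma> x)) u)" for u
    by (induction u) (simp_all add: subst_one[OF \<tau>] subst_mult[OF \<tau>])
  have "coeff (subst \<tau> (subst \<sigma> f)) v
      = (\<Sum>w\<in>?L (length v). \<Sum>u\<in>?L (length v). coeff f u * (coeff (prod_list (map \<sigma> u)) w * coeff (prod_list (map \<tau> w)) v))"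
    unfolding coeff_subst_hom[OF \<tau>]
    by (intro sum.cong refl) (simp add: coeff_subst_hom[OF \<sigma>] sum_distrib_right mult.assoc)
  also have "\<dots> = (\<Sum>u\<in>?L (length v). coeff f u * coeff (subst \<tau> (prod_list (map \<sigma> u))) v)"
    by (subst sum.swap) (simp add: coeff_subst_hom[OF \<tau>] sum_distrib_left)
  finally show "coeff (subst \<tau> (subst \<sigma> f)) v = coeff (subst (\<lambda>x. subst \<tau> (\<sigma> x)) f) v"
    by (simp add: coeff_subst_hom[OF hom] word)
qed

abbreviation A_to_C :: "ab3 \<Rightarrow> (ab3, 'k::field) ncps"
  where "A_to_C \<equiv> case_ab3 (- total) (case_bit (var (B 0)) (var (B 1)))"

abbreviation B_swap :: "ab3 \<Rightarrow> (ab3, 'k::field) ncps"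
  where "B_swap \<equiv> case_ab3 (var A) (case_bit (var (B 1)) (var (B 0)))"

lemma hom_part_case_ab3:
  assumes "hom_part 1 X = X" "hom_part 1 Y0 = Y0" "hom_part 1 Y1 = Y1"
  shows "hom_part 1 (case_ab3 X (case_bit Y0 Y1) x) = case_ab3 X (case_bit Y0 Y1) x"
  using assms by (auto split: ab3.split bit.split)

lemma hom_part_uminus_total: "hom_part 1 (- total) = - total"
  using hom_part_total by (simp add: hom_part_uminus)

lemmas hom_A_to_C = hom_part_case_ab3[OF hom_part_uminus_total hom_part_var hom_part_var]
lemmas hom_B_swap = hom_part_case_ab3[OF hom_part_var hom_part_var hom_part_var]

lemma subst_subst3:
  assumes \<tau>: "\<And>x. hom_part 1 (\<tau> x) = \<tau> x"
    and "hom_part 1 X = X" "hom_part 1 Y0 = Y0" "hom_part 1 Y1 = Y1"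
  shows "subst \<tau> (subst3 \<psi> X Y0 Y1) = subst3 \<psi> (subst \<tau> X) (subst \<tau> Y0) (subst \<tau> Y1)"
proof -
  have "(\<lambda>x. subst \<tau> (case_ab3 X (case_bit Y0 Y1) x)) = case_ab3 (subst \<tau> X) (case_bit (subst \<tau> Y0) (subst \<tau> Y1))"
    by (auto split: ab3.split bit.split)
  then show ?thesis
    unfolding subst3_def by (simp only: subst_subst[OF hom_part_case_ab3[OF assms(2-4)] \<tau>])
qed

lemma subst_total:
  fixes \<sigma> :: "ab3 \<Rightarrow> ('z, 'k::field) ncps"
  assumes hom: "\<And>x. hom_part 1 (\<sigma> x) = \<sigma> x"
  shows "subst \<sigma> total = \<sigma> A + \<sigma> (B 0) + \<sigma> (B 1)"
  unfolding total_def by (simp add: subst_add[OF hom] subst_var[OF hom])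

text \<open>With C = \<open>- total\<close> this means that C goes to A, so \<open>A_to_C\<close>
  exchanges A and C.\<close>

lemma subst_A_to_C_total: "subst A_to_C total = - var A"
  unfolding subst_total[OF hom_A_to_C] by (simp add: total_def)

lemma subst_B_swap_total: "subst B_swap total = total"
  unfolding subst_total[OF hom_B_swap] by (simp add: total_def)

lemma subst_A_to_C_octagon: "subst A_to_C (octagon_series \<psi>) = - octagon_series \<psi>"
  unfolding octagon_series_def
  by (simp add: subst_add[OF hom_A_to_C] subst_diff[OF hom_A_to_C] subst_subst3[OF hom_A_to_C] subst_var[OF hom_A_to_C]
    hom_part_var[simplified] hom_part_uminus_total[simplified] subst_uminus subst_A_to_C_total)

lemma subst_B_swap_octagon: "subst B_swap (octagon_series \<psi>) = - octagon_series \<psi>"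
  unfolding octagon_series_def
  by (simp add: subst_add[OF hom_B_swap] subst_diff[OF hom_B_swap] subst_subst3[OF hom_B_swap] subst_var[OF hom_B_swap]
    hom_part_var[simplified] hom_part_uminus_total[simplified] subst_uminus subst_B_swap_total)

lemma coeff_var_power: "coeff (var x ^ n) w = (if w = replicate n x then 1 else 0)"
  by (induction n arbitrary: w) (auto simp: coeff_one coeff_var_mult split: list.split)

lemma coeff_total_power: "coeff (total ^ n) w = (if length w = n then 1 else 0)"
proof (induction n arbitrary: w)
  case (Suc n)
  show ?case
  proof (cases w)
    case (Cons x v)
    have "x \<in> {A, B 0, B 1}"
      using UNIV_ab3 by blast
    with Cons Suc show ?thesis
      by (auto simp: total_def distrib_right coeff_var_mult)
  qed (simp add: total_def distrib_right coeff_var_mult)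
qed (simp add: coeff_one)

lemma coeff_uminus_var_power:
  assumes "w \<noteq> replicate n x"
  shows "coeff ((- var x) ^ n :: ('x, 'k::field) ncps) w = 0"
proof (cases "even n")
  case True
  then have "(- var x) ^ n = (var x ^ n :: ('x, 'k) ncps)"
    by (rule power_minus_even)
  with assms show ?thesis
    by (simp add: coeff_var_power)
next
  case False
  then have "(- var x) ^ n = - (var x ^ n :: ('x, 'k) ncps)"
    by (rule power_minus_odd)
  with assms show ?thesis
    by (simp add: coeff_var_power)
qed

text \<open>By the chain rule for \<open>A_to_C\<close>: the letter A occurs only in the image of A,
  with coefficient -1, so \<open>rquot A H\<close> is invariant; B(s) occurs in the images of A and
  of B(s), which gives the second formula. It holds for both \<open>s\<close>, so
  \<open>rquot A H\<close> is obtained twice.\<close>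

lemma rquot_symmetries:
  fixes H :: "(ab3, 'k::field) ncps"
  assumes A_to_C: "subst A_to_C H = - H" and B_swap: "subst B_swap H = - H"
  shows "rquot (B 1) H = - subst B_swap (rquot (B 0) H)"
    and "rquot A H = rquot (B s) H + subst A_to_C (rquot (B s) H)"
proof -
  have uminus: "rquot x (- H) = - rquot x H" for x
    by (simp add: ncps_eq_iff)
  have "- rquot (B 1) H = subst B_swap (rquot (B 0) H)"
    unfolding uminus[symmetric] B_swap[symmetric] rquot_subst[OF hom_B_swap]
    by (simp add: UNIV_ab3 coeff_var scale_zero_left scale_one)
  then show "rquot (B 1) H = - subst B_swap (rquot (B 0) H)"
    by (metis minus_minus)
  have minus_one: "scale (- 1) f = - f" for f :: "(ab3, 'k) ncps"
    by (simp add: ncps_eq_iff)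
  have A: "- rquot A H = - subst A_to_C (rquot A H)"
    unfolding uminus[symmetric] A_to_C[symmetric] rquot_subst[OF hom_A_to_C]
    by (simp add: UNIV_ab3 coeff_var scale_zero_left scale_one total_def minus_one)
  have "- rquot (B s) H = - subst A_to_C (rquot A H) + subst A_to_C (rquot (B s) H)"
    unfolding uminus[symmetric] A_to_C[symmetric] rquot_subst[OF hom_A_to_C]
    by (cases s) (simp_all add: UNIV_ab3 coeff_var scale_zero_left scale_one total_def minus_one)
  with A show "rquot A H = rquot (B s) H + subst A_to_C (rquot (B s) H)"
    by (simp add: algebra_simps)
qed

text \<open>\<open>A0\<close> and \<open>A1\<close> are the two expressions for
  \<open>rquot A H\<close>, from \<open>s = 0\<close> and \<open>s = 1\<close>; comparing them on
  two words gives c = 0 and c' = 0, and then all right quotients of \<open>H\<close> vanish.\<close>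

lemma eq_zero_of_symmetries:
  fixes H :: "(ab3, 'k::field_char_0) ncps"
  assumes A_to_C: "subst A_to_C H = - H" and B_swap: "subst B_swap H = - H"
    and const: "coeff H [] = 0" and n: "n \<ge> 2"
    and B0: "rquot (B 0) H = scale c (total ^ n) + scale c' (var (B 0) ^ n)"
  shows "H = 0"
proof -
  note symmetries = rquot_symmetries[OF A_to_C B_swap]
  have B1: "rquot (B 1) H = - (scale c (total ^ n) + scale c' (var (B 1) ^ n))"
    unfolding symmetries(1) B0
    by (simp add: subst_add[OF hom_B_swap] subst_scale[OF hom_B_swap] subst_power[OF hom_B_swap] subst_var[OF hom_B_swap] subst_B_swap_total)
  have A0: "rquot A H = scale c (total ^ n) + scale c' (var (B 0) ^ n) + (scale c ((- var A) ^ n) + scale c' (var (B 0) ^ n))"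
    unfolding symmetries(2)[of 0] B0
    by (simp add: subst_add[OF hom_A_to_C] subst_scale[OF hom_A_to_C] subst_power[OF hom_A_to_C] subst_var[OF hom_A_to_C] subst_A_to_C_total)
  have A1: "rquot A H = - (scale c (total ^ n) + scale c' (var (B 1) ^ n)) - (scale c ((- var A) ^ n) + scale c' (var (B 1) ^ n))"
    unfolding symmetries(2)[of 1] B1 subst_uminus
    by (simp add: subst_add[OF hom_A_to_C] subst_scale[OF hom_A_to_C] subst_power[OF hom_A_to_C] subst_var[OF hom_A_to_C] subst_A_to_C_total)
  obtain m where m: "n = Suc (Suc m)"
    using n by (auto simp: numeral_2_eq_2 dest: le_Suc_ex)
  have eq: "coeff (scale c (total ^ n) + scale c' (var (B 0) ^ n) + (scale c ((- var A) ^ n) + scale c' (var (B 0) ^ n))) w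
    = coeff (- (scale c (total ^ n) + scale c' (var (B 1) ^ n)) - (scale c ((- var A) ^ n) + scale c' (var (B 1) ^ n))) w" for w
    unfolding A0[symmetric] A1[symmetric] ..
  \<comment> \<open>A word of length \<open>n\<close> that is not a power of a letter, available
    because \<open>n \<ge> 2\<close>. It occurs only in \<open>total ^ n\<close>, with coefficient c
    in \<open>A0\<close> and -c in \<open>A1\<close>.\<close>
  let ?w = "B 0 # B 1 # replicate m (B 0)"
  have "?w \<noteq> replicate n x" for x
    by (cases "x = B 0") (simp_all add: m)
  then have "2 * c = 0"
    using eq[of ?w] by (simp add: coeff_var_power coeff_total_power coeff_uminus_var_power m del: power_Suc)
  then have c: "c = 0"
    by simp
  \<comment> \<open>The word B(0)^n now occurs twice in \<open>A0\<close>, from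
    \<open>rquot (B 0) H\<close> and from its image under \<open>A_to_C\<close>, and not in
    \<open>A1\<close>, where the only powers left are those of B(1).\<close>
  have "4 * c' = 0"
    using eq[of "replicate n (B 0)"]
    by (simp add: c coeff_var_power m del: power_Suc)
  then have c': "c' = 0"
    by simp
  have "rquot x H = 0" for x
  proof -
    have "x \<in> {A, B 0, B 1}"
      using UNIV_ab3 by blast
    then show ?thesis
      using A0 B0 B1 by (auto simp: c c' scale_zero_left)
  qed
  then have "coeff H (v @ [x]) = 0" for v x
    by (metis coeff_rquot coeff_zero)
  then have "coeff H w = 0" for w
    using const by (cases w rule: rev_cases) auto
  then show ?thesis
    by (simp add: ncps_eq_iff)
qed

section \<open>Degrees at most two, and the octagon equation\<close>

lemma subst3_one:
  assumes "hom_part 1 X = X" "hom_part 1 Y0 = Y0" "hom_part 1 Y1 = Y1"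
  shows "hom_part 1 (subst3 \<psi> X Y0 Y1)
    = scale (coeff \<psi> [A]) X + scale (coeff \<psi> [B 0]) Y0 + scale (coeff \<psi> [B 1]) Y1"
proof -
  note hom = hom_part_case_ab3[OF assms]
  have "hom_part 1 \<psi> = scale (coeff \<psi> [A]) (var A) + scale (coeff \<psi> [B 0]) (var (B 0)) + scale (coeff \<psi> [B 1]) (var (B 1))"
  proof -
    have "coeff (hom_part 1 \<psi>) w
      = coeff (scale (coeff \<psi> [A]) (var A) + scale (coeff \<psi> [B 0]) (var (B 0)) + scale (coeff \<psi> [B 1]) (var (B 1))) w" for w
    proof (cases "length w = 1")
      case True
      then obtain x where w: "w = [x]"
        by (auto simp: length_Suc_conv)
      have "x \<in> {A, B 0, B 1}"
        using UNIV_ab3 by blast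
      with w show ?thesis
        by (auto simp: coeff_hom_part coeff_var)
    qed (auto simp: coeff_hom_part coeff_var)
    then show ?thesis
      by (simp add: ncps_eq_iff)
  qed
  then show ?thesis
    unfolding subst3_def subst_hom_part[OF hom]
    by (simp add: subst_add[OF hom] subst_scale[OF hom] subst_var[OF hom])
qed

text \<open>In degree 1 each of A, B(0), B(1), C receives every coefficient of psi as often with a
  plus as with a minus sign; in degrees 0 and 2, psi itself has no component.\<close>

lemma octagon_series_low_degree:
  assumes "\<psi> \<in> free_lie UNIV" "hom_part 2 \<psi> = 0" "d \<le> 2"
  shows "hom_part d (octagon_series \<psi>) = 0"
proof (cases "d = 1")
  case True
  note one = subst3_one[OF hom_part_var hom_part_var hom_part_var] subst3_one[OF hom_part_uminus_total hom_part_var hom_part_var]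
  show ?thesis
    unfolding True octagon_series_def hom_part_add hom_part_diff one by (simp add: ncps_eq_iff)
next
  case False
  have "hom_part 0 \<psi> = 0"
    using free_lie_coeffs(1)[OF assms(1)] by (simp add: ncps_eq_iff coeff_hom_part)
  moreover have "d = 0 \<or> d = 2"
    using False assms(3) by linarith
  ultimately have \<psi>: "hom_part d \<psi> = 0"
    using assms(2) by auto
  have "hom_part d (subst3 \<psi> X Y0 Y1) = 0"
    if "hom_part 1 X = X" "hom_part 1 Y0 = Y0" "hom_part 1 Y1 = Y1" for X Y0 Y1 :: "(ab3, 'a) ncps"
    unfolding subst3_def subst_hom_part[OF hom_part_case_ab3[OF that]] \<psi> by (rule subst_zero)
  then show ?thesis
    unfolding octagon_series_def hom_part_add hom_part_diff
    by (simp add: hom_part_var[simplified] hom_part_uminus_total[simplified])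
qed

theorem theorem0p2:
  fixes \<phi> :: "(ab, 'k::field_char_0) ncps" and \<psi> :: "(ab3, 'k) ncps"
    and C :: "(ab3, 'k) ncps"
  assumes "\<phi> \<in> free_lie UNIV" and "\<psi> \<in> free_lie UNIV"
    and "coeff \<psi> [B 0] = 0" and "coeff \<psi> [A, B 0] = 0"
    and "t_class 4
          (subst3 \<psi> (t1 2) (tp 2 3 + tp 2 4) (tm 2 3 + tm 2 4)
           + subst3 \<psi> (t1 3 + tp 2 3 + tm 2 3) (tp 3 4) (tm 3 4))
       = t_class 4
          (subst2 \<phi> (tp 2 3) (tp 3 4)
           + subst3 \<psi> (t1 2 + t1 3 + tp 2 3 + tm 2 3) (tp 2 4 + tp 3 4) (tm 2 4 + tm 3 4)
           + subst3 \<psi> (t1 2) (tp 2 3) (tm 2 3))"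
    and "var A + var (B 0) + var (B 1) + C = 0"
  shows "subst3 \<psi> (var A) (var (B 0)) (var (B 1)) - subst3 \<psi> (var A) (var (B 1)) (var (B 0))
       + subst3 \<psi> C (var (B 1)) (var (B 0)) - subst3 \<psi> C (var (B 0)) (var (B 1)) = 0"
proof -
  have C: "C = - total"
    using assms(6) unfolding total_def by (metis add.inverse_unique)
  have "hom_part d (octagon_series \<psi>) = 0" for d
  proof (cases "d \<le> 2")
    case True
    then show ?thesis
      using octagon_series_low_degree[OF assms(2) degree_two_eq_zero[OF assms(1,2,4,5)]] by blast
  next
    case False
    \<comment> \<open>A right quotient lowers the degree by one, so degree 3 of the defect is the
      first to reach \<open>n = 2\<close>.\<close>
    then obtain n where n: "d = Suc n" "n \<ge> 2"
      by (cases d) auto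
    obtain c c' where "rquot (B 0) (hom_part d (octagon_series \<psi>)) = scale c (total ^ n) + scale c' (var (B 0) ^ n)"
      using rquot_octagon_series[OF assms(5)] n(1) by blast
    then show ?thesis
    proof (rule eq_zero_of_symmetries[rotated 4])
      show "subst A_to_C (hom_part d (octagon_series \<psi>)) = - hom_part d (octagon_series \<psi>)"
        by (simp add: subst_hom_part[OF hom_A_to_C, symmetric] subst_A_to_C_octagon hom_part_uminus)
      show "subst B_swap (hom_part d (octagon_series \<psi>)) = - hom_part d (octagon_series \<psi>)"
        by (simp add: subst_hom_part[OF hom_B_swap, symmetric] subst_B_swap_octagon hom_part_uminus)
    qed (use n in \<open>auto simp: coeff_hom_part\<close>)
  qed
  then have "coeff (octagon_series \<psi>) w = 0" for w
    by (metis coeff_hom_part coeff_zero)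
  then show ?thesis
    unfolding C octagon_series_def[symmetric] by (simp add: ncps_eq_iff)
qed

end
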